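(* For $\varepsilon\in\mathbb D\setminus\{0\}$ let $g_\varepsilon$ denote the pluricomplex Green function of the bidisk $\mathbb D^2$ with respect to the three poles $(0,0)$, $(\varepsilon,0)$, $(0,\varepsilon)$. If $g:\mathbb D^2\to[-\infty,0]$ is a cluster point of the family $\{g_\varepsilon\}$ as $\varepsilon\to0$, i.e. $g(z)=\lim_{k\to\infty}g_{\varepsilon_k}(z)$ for every $z\in\mathbb D^2$, for some sequence $\varepsilon_k\in\mathbb D\setminus\{0\}$ with $\varepsilon_k\to0$, then for any $z\in\mathbb D^2$, $$g(z)\le\frac32\log|z|,$$ and $g(z_1,-z_1)=2\log|z_1|$ for every $z_1\in\mathbb D$.
   Context: $\mathbb D$ is the open unit disc in $\mathbb C$. For $z=(z_1,z_2)\in\mathbb C^2$, $|z|:=\max(|z_1|,|z_2|)$, and $\log0=-\infty$. For a domain $\Omega$ and poles $a_0,\dots,a_N\in\Omega$, the pluricomplex Green function is $$g(z):=\sup\{u(z): u\in PSH(\Omega,\mathbb R_-),\ u(w)\le\log|w-a_j|+C_j\ \text{for } w\in\Omega,\ j=0,\dots,N,\ \text{for some constants } C_j \text{ depending on } u\},$$ where $PSH(\Omega,\mathbb R_-)$ is the set of all negative plurisubharmonic functions on $\Omega$. *)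

theory Defs
  imports "HOL-Analysis.Analysis"
begin

text \<open>
  The logarithm with values in the extended reals; it is only ever applied to norms.
\<close>

definition elog :: "real \<Rightarrow> ereal" where
  "elog x = (if x \<le> 0 then -\<infinity> else ereal (ln x))"

text \<open>
  The maximum norm, as opposed to the Euclidean norm that the product type carries.
\<close>

definition maxnorm :: "complex \<times> complex \<Rightarrow> real" where
  "maxnorm z = max (norm (fst z)) (norm (snd z))"

definition bidisk :: "(complex \<times> complex) set" where
  "bidisk = ball 0 1 \<times> ball 0 1"

definition usc_on :: "'a::topological_space set \<Rightarrow> ('a \<Rightarrow> ereal) \<Rightarrow> bool" where
  "usc_on S u \<longleftrightarrow> (\<forall>c. openin (top_of_set S) {x\<in>S. u x < c})"

text \<open>
  The mean of an extended real-valued function over a circle is the integral of the positive part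
  minus the integral of the negative part (\<^const>\<open>e2ennreal\<close> truncates negative values
  to 0). For an upper semicontinuous function with values below \<open>\<infinity>\<close>, the first
  integral is finite, so the difference is meaningful; it may be \<open>-\<infinity>\<close>.
\<close>

definition circle_mean :: "(complex \<Rightarrow> ereal) \<Rightarrow> complex \<Rightarrow> real \<Rightarrow> ereal" where
  "circle_mean u c r = ereal (1 / (2 * pi)) *
     (enn2ereal (\<integral>\<^sup>+ t\<in>{0..2*pi}. e2ennreal (u (c + of_real r * cis t)) \<partial>lborel)
    - enn2ereal (\<integral>\<^sup>+ t\<in>{0..2*pi}. e2ennreal (- u (c + of_real r * cis t)) \<partial>lborel))"

text \<open>
  The function that is constantly \<open>-\<infinity>\<close> counts as (pluri)subharmonic here. This has no
  influence on the Green function below, since the supremum of the empty set of extended reals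
  is \<open>-\<infinity>\<close> as well.
\<close>

definition subharmonic_on :: "complex set \<Rightarrow> (complex \<Rightarrow> ereal) \<Rightarrow> bool" where
  "subharmonic_on U u \<longleftrightarrow>
     usc_on U u \<and> (\<forall>x\<in>U. u x < \<infinity>) \<and>
     (\<forall>c r. r > 0 \<and> cball c r \<subseteq> U \<longrightarrow> u c \<le> circle_mean u c r)"

definition psh_on :: "(complex \<times> complex) set \<Rightarrow> (complex \<times> complex \<Rightarrow> ereal) \<Rightarrow> bool" where
  "psh_on \<Omega> u \<longleftrightarrow>
     usc_on \<Omega> u \<and> (\<forall>z\<in>\<Omega>. u z < \<infinity>) \<and>
     (\<forall>a b. subharmonic_on {\<zeta>. (fst a + \<zeta> * fst b, snd a + \<zeta> * snd b) \<in> \<Omega>}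
              (\<lambda>\<zeta>. u (fst a + \<zeta> * fst b, snd a + \<zeta> * snd b)))"

definition green_class ::
  "(complex \<times> complex) set \<Rightarrow> (complex \<times> complex) set \<Rightarrow> (complex \<times> complex \<Rightarrow> ereal) set" where
  "green_class \<Omega> A =
     {u. psh_on \<Omega> u \<and> (\<forall>w\<in>\<Omega>. u w \<le> 0) \<and>
         (\<forall>a\<in>A. \<exists>C::real. \<forall>w\<in>\<Omega>. u w \<le> elog (maxnorm (w - a)) + ereal C)}"

definition green ::
  "(complex \<times> complex) set \<Rightarrow> (complex \<times> complex) set \<Rightarrow> complex \<times> complex \<Rightarrow> ereal" where
  "green \<Omega> A z = (SUP u\<in>green_class \<Omega> A. u z)"

end

theory Submission
  imports Defs "HOL-Complex_Analysis.Cauchy_Integral_Formula"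
begin

text \<open>
  Why the theorem is true. Upper bounds for the Green function come from curves through the poles.
  Suppose that a curve \<open>\<phi>(\<zeta>) = p + \<zeta> m + \<zeta>\<^sup>2 n\<close>, a parabola or a line, maps the disc of radius
  \<open>R\<close> into the bidisk and meets the poles at \<open>N\<close> different parameters \<open>\<sigma>\<^sub>j\<close>. For a competitor \<open>u\<close>
  the function \<open>u \<circ> \<phi>\<close> is negative and subharmonic with a logarithmic pole at each \<open>\<sigma>\<^sub>j\<close>, so it is
  at most \<open>\<Sum>\<^sub>j ln (\<bar>\<zeta> - \<sigma>\<^sub>j\<bar> / (R - \<bar>\<sigma>\<^sub>j\<bar>))\<close> (\<open>green_class_parabola_bound\<close>). If the poles merge and all
  \<open>\<sigma>\<^sub>j\<close> tend to 0, this tends to \<open>N ln (\<bar>\<zeta>\<bar> / R)\<close>.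

  Let \<open>z = (z\<^sub>1, z\<^sub>2)\<close> with \<open>z\<^sub>1\<close>, \<open>z\<^sub>2\<close> and \<open>z\<^sub>1 + z\<^sub>2\<close> nonzero. Among the conics through the three poles and
  \<open>z\<close> there is a parabola that, with \<open>z\<close> at parameter 1, meets the poles at parameters of order
  \<open>sqrt \<bar>\<epsilon>\<bar>\<close> and tends to the doubly covered disc \<open>\<zeta> \<mapsto> \<zeta>\<^sup>2 z\<close>. The latter stays in the bidisk up to the
  radius \<open>1 / sqrt \<bar>z\<bar>\<close>, and three poles give \<open>3 / 2 log \<bar>z\<bar>\<close>. The exceptional
  points are better: the coordinate axes contain two poles each, and a nearly straight parabola
  through \<open>(\<epsilon>, 0)\<close> and \<open>(0, \<epsilon>)\<close> hits the point \<open>(z\<^sub>1, - z\<^sub>1)\<close>. Such a curve has only two poles, but it is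
  parametrised by a coordinate and stays in the bidisk up to radii close to 1, which gives \<open>2 log \<bar>z\<bar>\<close>.

  The lower bound on the antidiagonal uses one competitor: \<open>z\<^sub>1 (z\<^sub>1 - \<epsilon>)\<close>, \<open>z\<^sub>2 (z\<^sub>2 - \<epsilon>)\<close> and \<open>z\<^sub>1 z\<^sub>2\<close> vanish at
  the three poles, and the logarithm of the largest of their moduli, normalised to be negative, is
  at least \<open>2 log \<bar>z\<^sub>1\<bar> - log (1 + \<bar>\<epsilon>\<bar>)\<close> at \<open>(z\<^sub>1, - z\<^sub>1)\<close>.

  Plurisubharmonicity speaks of complex lines only, whereas the upper bound needs it along
  parabolas. Instead of smoothing \<open>u\<close>, \<open>psh_parabola_strict_comparison\<close> proves the maximum
  principle directly: \<open>u\<close> minus a strictly superharmonic function of \<open>\<zeta>\<close> minus \<open>K \<bar>w\<bar>\<^sup>2\<close> is maximised on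
  a neighbourhood of the parabola, where \<open>w\<close> is the displacement from it, and the submean
  inequality is violated on the line through the maximum point that is tangent to a translate of the
  parabola. Along that line \<open>w\<close> varies only to second order, so \<open>K \<bar>w\<bar>\<^sup>2\<close> changes the mean over a circle of
  radius \<open>r\<close> only by \<open>K r\<^sup>4\<close>.
\<close>

section \<open>Means over circles\<close>

text \<open>
  The circle mean is a difference of two nonnegative integrals, whereas explicit computations
  yield Henstock-Kurzweil integrals; for continuous integrands this passes from one to the other.
\<close>

lemma nn_integral_parts_continuous:
  fixes f :: "real \<Rightarrow> real"
  assumes cont: "continuous_on {a..b} f" and int: "(f has_integral I) {a..b}"
  shows "(\<integral>\<^sup>+ t\<in>{a..b}. ennreal (f t) \<partial>lborel) < \<infinity>"
    and "(\<integral>\<^sup>+ t\<in>{a..b}. ennreal (- f t) \<partial>lborel) < \<infinity>"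
    and "enn2ereal (\<integral>\<^sup>+ t\<in>{a..b}. ennreal (f t) \<partial>lborel)
       - enn2ereal (\<integral>\<^sup>+ t\<in>{a..b}. ennreal (- f t) \<partial>lborel) = ereal I"
proof -
  let ?g = "\<lambda>t. indicator {a..b} t * f t"
  let ?P = "\<integral>\<^sup>+ t\<in>{a..b}. ennreal (f t) \<partial>lborel"
  let ?N = "\<integral>\<^sup>+ t\<in>{a..b}. ennreal (- f t) \<partial>lborel"
  have si: "set_integrable lborel {a..b} f"
    by (rule borel_integrable_atLeastAtMost'[OF cont])
  then have ig: "integrable lborel ?g"
    by (simp add: set_integrable_def)
  have P: "(\<integral>\<^sup>+ t. ennreal (?g t) \<partial>lborel) = ?P"
    and N: "(\<integral>\<^sup>+ t. ennreal (- ?g t) \<partial>lborel) = ?N"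
    by (auto intro!: nn_integral_cong split: split_indicator)
  show Pf: "?P < \<infinity>" and Nf: "?N < \<infinity>"
    using ig P N unfolding real_integrable_def by (auto simp: top.not_eq_extremum)
  have "integral\<^sup>L lborel ?g = I"
    using set_borel_integral_eq_integral(2)[OF si] int
    by (simp add: set_lebesgue_integral_def integral_unique)
  then have "enn2real ?P - enn2real ?N = I"
    using real_lebesgue_integral_def[OF ig] P N by simp
  then show "enn2ereal ?P - enn2ereal ?N = ereal I"
    using Pf Nf by (cases ?P; cases ?N) auto
qed

lemma circle_mean_mono:
  assumes "\<And>t. u (c + of_real r * cis t) \<le> v (c + of_real r * cis t)"
  shows "circle_mean u c r \<le> circle_mean v c r"
  unfolding circle_mean_def
  by (intro ereal_mult_left_mono ereal_minus_mono)
     (auto intro!: nn_integral_mono mult_right_mono e2ennreal_mono assms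
        simp: less_eq_ennreal.rep_eq[symmetric])

lemma circle_mean_le_integral:
  assumes "continuous_on {0..2*pi} f" and "(f has_integral 2 * pi * I) {0..2*pi}"
    and le: "\<And>t. u (c + of_real r * cis t) \<le> ereal (f t)"
  shows "circle_mean u c r \<le> ereal I"
proof -
  let ?P = "\<integral>\<^sup>+ t\<in>{0..2*pi}. e2ennreal (u (c + of_real r * cis t)) \<partial>lborel"
  let ?N = "\<integral>\<^sup>+ t\<in>{0..2*pi}. e2ennreal (- u (c + of_real r * cis t)) \<partial>lborel"
  have "?P \<le> (\<integral>\<^sup>+ t\<in>{0..2*pi}. ennreal (f t) \<partial>lborel)"
    by (intro nn_integral_mono mult_right_mono) (use e2ennreal_mono[OF le] in auto)
  moreover have "(\<integral>\<^sup>+ t\<in>{0..2*pi}. ennreal (- f t) \<partial>lborel) \<le> ?N"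
    by (intro nn_integral_mono mult_right_mono)
       (use le e2ennreal_mono[of "ereal (- f _)"] ereal_minus_le_minus in fastforce)+
  ultimately have "enn2ereal ?P - enn2ereal ?N \<le> ereal (2 * pi * I)"
    unfolding nn_integral_parts_continuous(3)[OF assms(1,2), symmetric]
    by (intro ereal_minus_mono) (auto simp: less_eq_ennreal.rep_eq)
  then have "circle_mean u c r \<le> ereal (1 / (2 * pi)) * ereal (2 * pi * I)"
    unfolding circle_mean_def by (intro ereal_mult_left_mono) auto
  then show ?thesis by simp
qed

text \<open>
  Reduces the submean inequality for a function with values \<open>-\<infinity>\<close> to continuous functions that
  decrease to it. The positive parts converge by dominated and the negative parts by monotone
  convergence, and the difference of the limits is meaningful because the positive parts stay
  below a finite integral.
\<close>

lemma circle_mean_ge_decreasing_limit: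
  fixes F :: "nat \<Rightarrow> real \<Rightarrow> real"
  assumes cont: "\<And>n. continuous_on {0..2*pi} (F n)"
    and decr: "\<And>n t. F (Suc n) t \<le> F n t"
    and lim: "\<And>t. (\<lambda>n. ereal (F n t)) \<longlonglongrightarrow> u (c + of_real r * cis t)"
    and int: "\<And>n. (F n has_integral I n) {0..2*pi}"
    and ge: "\<And>n. 2 * pi * L \<le> I n"
  shows "ereal L \<le> circle_mean u c r"
proof -
  let ?U = "\<lambda>t. u (c + of_real r * cis t)"
  define P where "P n = (\<integral>\<^sup>+ t\<in>{0..2*pi}. ennreal (F n t) \<partial>lborel)" for n
  define N where "N n = (\<integral>\<^sup>+ t\<in>{0..2*pi}. ennreal (- F n t) \<partial>lborel)" for n
  let ?P = "\<integral>\<^sup>+ t\<in>{0..2*pi}. e2ennreal (?U t) \<partial>lborel"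
  let ?N = "\<integral>\<^sup>+ t\<in>{0..2*pi}. e2ennreal (- ?U t) \<partial>lborel"
  have decr': "F n t \<le> F m t" if "m \<le> n" for m n t
    using lift_Suc_antimono_le[of "\<lambda>n. F n t"] decr that by blast
  have m: "(\<lambda>t. indicator {0..2*pi} t * F n t) \<in> borel_measurable lborel" for n
    using borel_integrable_atLeastAtMost'[OF cont[of n]]
    by (auto simp: set_integrable_def)
  have mP: "(\<lambda>t. ennreal (F n t) * indicator {0..2*pi} t) \<in> borel_measurable lborel" for n
  proof -
    have "(\<lambda>t. ennreal (indicator {0..2*pi} t * F n t)) \<in> borel_measurable lborel"
      using m by measurable
    also have "(\<lambda>t. ennreal (indicator {0..2*pi} t * F n t)) = (\<lambda>t. ennreal (F n t) * indicator {0..2*pi} t)"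
      by (auto split: split_indicator)
    finally show ?thesis .
  qed
  have mN: "(\<lambda>t. ennreal (- F n t) * indicator {0..2*pi} t) \<in> borel_measurable lborel" for n
  proof -
    have "(\<lambda>t. ennreal (- (indicator {0..2*pi} t * F n t))) \<in> borel_measurable lborel"
      using m by measurable
    also have "(\<lambda>t. ennreal (- (indicator {0..2*pi} t * F n t))) = (\<lambda>t. ennreal (- F n t) * indicator {0..2*pi} t)"
      by (auto split: split_indicator)
    finally show ?thesis .
  qed
  have limP: "(\<lambda>n. ennreal (F n t) * indicator {0..2*pi} t) \<longlonglongrightarrow> e2ennreal (?U t) * indicator {0..2*pi} t" for t
    using tendsto_e2ennrealI[OF lim[of t]] by (auto split: split_indicator)
  have limN: "(\<lambda>n. ennreal (- F n t) * indicator {0..2*pi} t) \<longlonglongrightarrow> e2ennreal (- ?U t) * indicator {0..2*pi} t" for t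
    using tendsto_e2ennrealI[OF tendsto_uminus_ereal[OF lim[of t]]] by (auto split: split_indicator)
  have measP: "(\<lambda>t. e2ennreal (?U t) * indicator {0..2*pi} t) \<in> borel_measurable lborel"
    by (rule borel_measurable_LIMSEQ_order[OF limP mP])
  have "P \<longlonglongrightarrow> ?P"
    unfolding P_def
  proof (rule nn_integral_dominated_convergence[where w = "\<lambda>t. ennreal (F 0 t) * indicator {0..2*pi} t"])
    show "(\<integral>\<^sup>+ t\<in>{0..2*pi}. ennreal (F 0 t) \<partial>lborel) < \<infinity>"
      by (rule nn_integral_parts_continuous(1)[OF cont int])
  qed (use mP limP measP decr' in \<open>auto intro!: mult_right_mono ennreal_leI\<close>)
  moreover have "N \<longlonglongrightarrow> ?N"
    unfolding N_def
    by (rule nn_integral_LIMSEQ[OF _ mN limN])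
       (auto simp: incseq_def le_fun_def intro!: mult_right_mono ennreal_leI decr')
  moreover have "P 0 < \<infinity>"
    unfolding P_def by (rule nn_integral_parts_continuous(1)[OF cont int])
  moreover have Ple: "?P \<le> P 0"
  proof -
    have "P n \<le> P 0" for n
      unfolding P_def by (intro nn_integral_mono mult_right_mono ennreal_leI decr') auto
    then show ?thesis
      using LIMSEQ_le_const2[OF \<open>P \<longlonglongrightarrow> ?P\<close>] by blast
  qed
  moreover have "enn2ereal ?P \<noteq> \<infinity>"
    using \<open>P 0 < \<infinity>\<close> Ple by (cases ?P) (auto simp: top_unique)
  moreover have "enn2ereal ?P \<noteq> - \<infinity>"
    using enn2ereal_nonneg[of ?P] by auto
  ultimately have "(\<lambda>n. enn2ereal (P n) - enn2ereal (N n)) \<longlonglongrightarrow> enn2ereal ?P - enn2ereal ?N"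
    unfolding minus_ereal_def
    by (intro tendsto_add_ereal_general tendsto_uminus_ereal tendsto_enn2erealI) auto
  moreover have "ereal (2 * pi * L) \<le> enn2ereal (P n) - enn2ereal (N n)" for n
    unfolding P_def N_def nn_integral_parts_continuous(3)[OF cont int] using ge by simp
  ultimately have "ereal (2 * pi * L) \<le> enn2ereal ?P - enn2ereal ?N"
    using LIMSEQ_le_const by blast
  then have "ereal (1 / (2 * pi)) * ereal (2 * pi * L) \<le> circle_mean u c r"
    unfolding circle_mean_def by (intro ereal_mult_left_mono) auto
  then show ?thesis by simp
qed

text \<open>
  Up to the constant \<open>ln \<bar>a\<bar>\<close> the integrand is the real part of \<open>Ln (1 + (b / a) w)\<close>, which is
  holomorphic on the closed unit disc since \<open>1 + (b / a) w\<close> has positive real part there. Cauchy's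
  formula evaluates its mean as the value at the centre.
\<close>

lemma integral_ln_norm_affine:
  fixes a b :: complex
  assumes "norm b < norm a"
  shows "((\<lambda>t. ln (norm (a + b * cis t))) has_integral 2 * pi * ln (norm a)) {0..2*pi}"
proof -
  have a: "a \<noteq> 0" using assms by auto
  define q where "q = b / a"
  have q: "norm q < 1" using assms a by (simp add: q_def norm_divide)
  have pos: "Re (1 + q * w) > 0" if "norm w \<le> 1" for w
  proof -
    have "norm (q * w) < 1"
      using q that mult_left_le[of "norm w" "norm q"] by (simp add: norm_mult)
    then show ?thesis using abs_Re_le_cmod[of "q * w"] by simp
  qed
  have "(\<lambda>w. Ln (1 + q * w)) holomorphic_on cball 0 1"
  proof (intro holomorphic_intros)
    show "1 + q * z \<notin> \<real>\<^sub>\<le>\<^sub>0" if "z \<in> cball 0 1" for z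
      using pos[of z] that by (auto simp: complex_nonpos_Reals_iff)
  qed
  then have "((\<lambda>u. Ln (1 + q * u) / (u - 0)) has_contour_integral (2 * of_real pi * \<i> * Ln (1 + q * 0))) (circlepath 0 1)"
    by (rule Cauchy_integral_circlepath_simple) auto
  then have "((\<lambda>t. Ln (1 + q * cis t) / cis t * \<i> * cis t) has_integral 0) {0..2*pi}"
    by (simp add: circlepath_def has_contour_integral_part_circlepath_iff)
  then have "((\<lambda>t. Re (- \<i> * (Ln (1 + q * cis t) / cis t * \<i> * cis t))) has_integral Re (- \<i> * 0)) {0..2*pi}"
    by (intro has_integral_Re has_integral_mult_right)
  moreover have "Re (- \<i> * (Ln (1 + q * cis t) / cis t * \<i> * cis t)) = ln (norm (a + b * cis t)) - ln (norm a)" for t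
  proof -
    have nz: "1 + q * cis t \<noteq> 0" using pos[of "cis t"]
      by (metis norm_cis order_refl less_irrefl zero_complex.sel(1))
    have "Re (- \<i> * (Ln (1 + q * cis t) / cis t * \<i> * cis t)) = Re (Ln (1 + q * cis t))"
      by (simp add: field_simps)
    also have "\<dots> = ln (norm (1 + q * cis t))" using nz by simp
    also have "a + b * cis t = a * (1 + q * cis t)" using a by (simp add: q_def field_simps)
    then have "ln (norm (1 + q * cis t)) = ln (norm (a + b * cis t)) - ln (norm a)"
      using a nz by (simp add: norm_mult ln_mult)
    finally show ?thesis .
  qed
  ultimately have "((\<lambda>t. ln (norm (a + b * cis t)) - ln (norm a)) has_integral 0) {0..2*pi}"
    by simp
  from has_integral_add[OF this has_integral_const_real[of "ln (norm a)" 0 "2*pi"]]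
  show ?thesis by simp
qed

text \<open>
  The submean inequality for \<open>ln \<bar>\<zeta> - c\<bar>\<close>, with an added \<open>d\<close> that keeps the integrand continuous. If
  the zero lies outside of the circle, the mean without \<open>d\<close> is exact; if it lies inside, the
  reflection \<open>\<bar>a + b w\<bar> = \<bar>cnj b + cnj a w\<bar>\<close> for \<open>\<bar>w\<bar> = 1\<close> moves it outside and the mean is even \<open>ln \<bar>b\<bar>\<close>.
\<close>

lemma integral_ln_norm_affine_regularised:
  fixes a b :: complex
  assumes a: "a \<noteq> 0" and d: "d > 0"
  shows "continuous_on {0..2*pi} (\<lambda>t. ln (norm (a + b * cis t) + d))"
    and "2 * pi * ln (norm a) \<le> integral {0..2*pi} (\<lambda>t. ln (norm (a + b * cis t) + d))"
proof -
  have contx: "continuous_on {0..2*pi} (\<lambda>t. ln (norm (x + y * cis t) + d))" for x y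
    using d by (intro continuous_intros) (auto simp: add_nonneg_eq_0_iff)
  show "continuous_on {0..2*pi} (\<lambda>t. ln (norm (a + b * cis t) + d))" by (rule contx)
  have ix: "(\<lambda>t. ln (norm (x + y * cis t) + d)) integrable_on {0..2*pi}" for x y
    by (rule integrable_continuous_interval[OF contx])
  have outside: "2 * pi * ln (norm x) \<le> integral {0..2*pi} (\<lambda>t. ln (norm (x + y * cis t) + d))"
    if "norm y < norm x" for x y
  proof (rule has_integral_le[OF integral_ln_norm_affine[OF that] integrable_integral[OF ix]])
    fix t
    have "x + y * cis t \<noteq> 0"
    proof
      assume "x + y * cis t = 0"
      then have "norm x = norm (- (y * cis t))" by (metis add_eq_0_iff2)
      then show False using that by (simp add: norm_mult)
    qed
    then show "ln (norm (x + y * cis t)) \<le> ln (norm (x + y * cis t) + d)"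
      using d by (subst ln_le_cancel_iff) (auto simp: add_pos_pos)
  qed
  show "2 * pi * ln (norm a) \<le> integral {0..2*pi} (\<lambda>t. ln (norm (a + b * cis t) + d))"
  proof (cases "norm b > norm a")
    case True
    have flip: "norm (a + b * cis t) = norm (cnj b + cnj a * cis t)" for t
    proof -
      have "norm (a + b * cis t) = norm (cnj (a + b * cis t)) * norm (cis t)"
        by (simp add: complex_mod_cnj del: complex_cnj_add complex_cnj_mult)
      also have "\<dots> = norm (cnj (a + b * cis t) * cis t)" by (simp add: norm_mult)
      also have "cnj (a + b * cis t) * cis t = cnj b + cnj a * cis t"
        by (simp add: algebra_simps cis_cnj cis_mult)
      finally show ?thesis .
    qed
    have "2 * pi * ln (norm a) \<le> 2 * pi * ln (norm (cnj b))"
      using True a by (intro mult_left_mono) (auto intro!: ln_mono)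
    also have "\<dots> \<le> integral {0..2*pi} (\<lambda>t. ln (norm (cnj b + cnj a * cis t) + d))"
      using True by (intro outside) auto
    finally show ?thesis by (simp only: flip)
  next
    case False
    \<comment> \<open>the zero may lie on the circle: scaling \<open>a\<close> by \<open>s > 1\<close> moves it outside, at a cost that vanishes as \<open>s\<close> tends to 1\<close>
    define h where "h s = 2 * pi * ln (s * norm a) - 2 * pi * ((s - 1) * norm a / d)" for s
    have "h s \<le> integral {0..2*pi} (\<lambda>t. ln (norm (a + b * cis t) + d))" if "s > 1" for s
    proof -
      have na: "norm (of_real s * a) = s * norm a" using that by (simp add: norm_mult)
      have "1 * norm a < s * norm a"
        using a that by (intro mult_strict_right_mono) auto
      then have "norm b < norm (of_real s * a)"
        using False na by linarith
      then have 1: "2 * pi * ln (s * norm a) \<le> integral {0..2*pi} (\<lambda>t. ln (norm (of_real s * a + b * cis t) + d))"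
        using outside[of b "of_real s * a"] na by simp
      have "ln (norm (of_real s * a + b * cis t) + d) \<le> ln (norm (a + b * cis t) + d) + (s - 1) * norm a / d" for t
      proof -
        let ?x = "norm (a + b * cis t) + d" and ?k = "(s - 1) * norm a"
        have k: "?k \<ge> 0" using that by simp
        have xd: "?x \<ge> d" by simp
        have eq: "of_real s * a + b * cis t = (a + b * cis t) + of_real (s - 1) * a"
          by (simp add: algebra_simps)
        have "norm (of_real s * a + b * cis t) \<le> norm (a + b * cis t) + ?k"
          unfolding eq using norm_triangle_ineq[of "a + b * cis t" "of_real (s - 1) * a"] that
          by (simp add: norm_mult del: of_real_diff)
        then have "ln (norm (of_real s * a + b * cis t) + d) \<le> ln (?x + ?k)"
          using d by (intro ln_mono) (auto intro: add_nonneg_pos)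
        also have "\<dots> = ln ?x + ln (1 + ?k / ?x)"
        proof -
          have x: "?x > 0" using d xd by linarith
          then have "1 + ?k / ?x > 0" using k by (intro add_pos_nonneg) auto
          moreover have "?x + ?k = ?x * (1 + ?k / ?x)"
            using x by (simp only: distrib_left mult_1_right) simp
          ultimately show ?thesis using ln_mult_pos[OF x] by metis
        qed
        also have "ln (1 + ?k / ?x) \<le> ?k / ?x"
          using d k xd by (intro ln_add_one_self_le_self) auto
        also have "?k / ?x \<le> ?k / d"
          using d k xd by (intro frac_le) auto
        finally show ?thesis by simp
      qed
      then have "integral {0..2*pi} (\<lambda>t. ln (norm (of_real s * a + b * cis t) + d))
          \<le> integral {0..2*pi} (\<lambda>t. ln (norm (a + b * cis t) + d) + (s - 1) * norm a / d)"
        by (intro integral_le integrable_add ix) auto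
      also have "\<dots> = integral {0..2*pi} (\<lambda>t. ln (norm (a + b * cis t) + d)) + 2 * pi * ((s - 1) * norm a / d)"
        by (subst integral_add[OF ix]) (auto intro: integrable_const_ivl)
      finally show ?thesis using 1 by (simp add: h_def)
    qed
    then have "\<forall>\<^sub>F s in at_right 1. h s \<le> integral {0..2*pi} (\<lambda>t. ln (norm (a + b * cis t) + d))"
      by (auto simp: eventually_at_right_less intro: eventually_mono[OF eventually_at_right_less])
    moreover have "(h \<longlongrightarrow> h 1) (at_right 1)"
      unfolding h_def using a d by (intro tendsto_intros) auto
    ultimately have "h 1 \<le> integral {0..2*pi} (\<lambda>t. ln (norm (a + b * cis t) + d))"
      by (intro tendsto_upperbound) auto
    then show ?thesis by (simp add: h_def)
  qed
qed

section \<open>A competitor vanishing at the three poles\<close>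

lemma elog_less_ereal_iff: "elog x < ereal c \<longleftrightarrow> x < exp c"
proof (cases "x > 0")
  case True
  then have "ln x < c \<longleftrightarrow> x < exp c"
    by (metis exp_less_cancel_iff exp_ln)
  then show ?thesis using True by (simp add: elog_def)
next
  case False
  then show ?thesis
    using le_less_trans[of x 0 "exp c"] by (auto simp: elog_def)
qed

lemma elog_mono: "x \<le> y \<Longrightarrow> elog x \<le> elog y"
  by (auto simp: elog_def)

lemma tendsto_elog:
  assumes "(f \<longlongrightarrow> x) F" and pos: "\<And>n. f n > 0"
  shows "((\<lambda>n. ereal (ln (f n))) \<longlongrightarrow> elog x) F"
proof (cases "x > 0")
  case True
  then show ?thesis
    using tendsto_ln[OF assms(1)] by (simp add: elog_def)
next
  case False
  have "eventually (\<lambda>n. ln (f n) < c) F" for c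
  proof -
    have "x < exp c" using False le_less_trans[OF _ exp_gt_zero, of x c] by simp
    then have "eventually (\<lambda>n. f n < exp c) F"
      by (rule order_tendstoD(2)[OF assms(1)])
    then show ?thesis
      by (rule eventually_mono) (metis pos exp_less_cancel_iff exp_ln)
  qed
  then show ?thesis
    using False by (auto simp: elog_def tendsto_MInfty not_less)
qed

lemma usc_on_elog:
  assumes "continuous_on S f"
  shows "usc_on S (\<lambda>x. elog (f x))"
  unfolding usc_on_def
proof
  fix c
  show "openin (top_of_set S) {x \<in> S. elog (f x) < c}"
  proof (cases c)
    case (real r)
    have "openin (top_of_set S) (S \<inter> f -` {..<exp r})"
      by (intro continuous_openin_preimage_gen assms) auto
    also have "S \<inter> f -` {..<exp r} = {x \<in> S. elog (f x) < c}"
      using real by (auto simp: elog_less_ereal_iff)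
    finally show ?thesis .
  next
    case PInf
    then have "{x \<in> S. elog (f x) < c} = S" by (auto simp: elog_def)
    then show ?thesis by simp
  qed simp
qed

text \<open>
  Products of two affine functions are what remains of the quadratic functions in the competitor on
  a complex line. Adding \<open>1 / (n + 1)\<close> to both moduli gives continuous functions that decrease to the
  logarithm, and the regularised inequality applies to the two factors separately.
\<close>

lemma elog_affine_product_submean:
  fixes a a' b b' c :: complex
  assumes k: "k > 0"
  shows "elog (k * norm (a + c * b) * norm (a' + c * b'))
    \<le> circle_mean (\<lambda>\<zeta>. elog (k * norm (a + \<zeta> * b) * norm (a' + \<zeta> * b'))) c r"
proof (cases "a + c * b = 0 \<or> a' + c * b' = 0")
  case True
  then show ?thesis by (auto simp: elog_def)
next
  case False
  define x where "x t = norm ((a + c * b) + (b * of_real r) * cis t)" for t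
  define y where "y t = norm ((a' + c * b') + (b' * of_real r) * cis t)" for t
  define d :: "nat \<Rightarrow> real" where "d n = 1 / (real n + 1)" for n
  have d: "d n > 0" for n by (simp add: d_def)
  have d0: "d \<longlonglongrightarrow> 0"
    unfolding d_def using LIMSEQ_inverse_real_of_nat by (simp add: inverse_eq_divide add.commute)
  have dd: "d (Suc n) \<le> d n" for n by (simp add: d_def field_simps)
  have xp: "x t + d n > 0" "y t + d n > 0" "x t \<ge> 0" "y t \<ge> 0" for t n
    using d by (auto simp: x_def y_def add_nonneg_pos)
  define F where "F n t = ln (k * (x t + d n) * (y t + d n))" for n t
  have F: "F n t = ln k + (ln (x t + d n) + ln (y t + d n))" for n t
    using k xp by (simp add: F_def ln_mult_pos)
  have cx: "continuous_on {0..2*pi} (\<lambda>t. ln (x t + d n))" 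
   and ix: "2 * pi * ln (norm (a + c * b)) \<le> integral {0..2*pi} (\<lambda>t. ln (x t + d n))" for n
    unfolding x_def using False d by (intro integral_ln_norm_affine_regularised; simp)+
  have cy: "continuous_on {0..2*pi} (\<lambda>t. ln (y t + d n))" 
   and iy: "2 * pi * ln (norm (a' + c * b')) \<le> integral {0..2*pi} (\<lambda>t. ln (y t + d n))" for n
    unfolding y_def using False d by (intro integral_ln_norm_affine_regularised; simp)+
  define L where "L = ln k + (ln (norm (a + c * b)) + ln (norm (a' + c * b')))"
  have "ereal L \<le> circle_mean (\<lambda>\<zeta>. elog (k * norm (a + \<zeta> * b) * norm (a' + \<zeta> * b'))) c r"
  proof (rule circle_mean_ge_decreasing_limit[where F = F])
    show cF: "continuous_on {0..2*pi} (F n)" for n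
      unfolding F by (intro continuous_on_add cx cy continuous_on_const)
    show "(F n has_integral integral {0..2*pi} (F n)) {0..2*pi}" for n
      by (intro integrable_integral integrable_continuous_interval cF)
    show "F (Suc n) t \<le> F n t" for n t
      unfolding F_def using k xp[of t] dd[of n]
      by (intro ln_mono mult_mono mult_pos_pos) (auto intro: less_imp_le)
    show "2 * pi * L \<le> integral {0..2*pi} (F n)" for n
    proof -
      have "(F n has_integral (2 * pi * ln k + (integral {0..2*pi} (\<lambda>t. ln (x t + d n))
          + integral {0..2*pi} (\<lambda>t. ln (y t + d n))))) {0..2*pi}"
        unfolding F using has_integral_const_real[of "ln k" 0 "2*pi"]
        by (intro has_integral_add integrable_integral integrable_continuous_interval cx cy) simp
      then show ?thesis
        using ix[of n] iy[of n] by (simp add: integral_unique L_def algebra_simps)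
    qed
    show "(\<lambda>n. ereal (F n t)) \<longlonglongrightarrow> elog (k * norm (a + (c + of_real r * cis t) * b) * norm (a' + (c + of_real r * cis t) * b'))" for t
    proof -
      have "(\<lambda>n. k * (x t + d n) * (y t + d n)) \<longlonglongrightarrow> k * (x t + 0) * (y t + 0)"
        by (intro tendsto_intros d0)
      then have "(\<lambda>n. ereal (F n t)) \<longlonglongrightarrow> elog (k * (x t + 0) * (y t + 0))"
        unfolding F_def by (rule tendsto_elog) (use k xp in simp)
      then show ?thesis by (simp add: x_def y_def algebra_simps)
    qed
  qed
  moreover have "elog (k * norm (a + c * b) * norm (a' + c * b')) = ereal L"
    using False k by (simp add: elog_def L_def ln_mult_pos mult_le_0_iff)
  ultimately show ?thesis by simp
qed

text \<open>
  For \<open>e \<noteq> 0\<close> the three polynomials generate the ideal of functions that vanish at \<open>(0, 0)\<close>, \<open>(e, 0)\<close> and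
  \<open>(0, e)\<close>. Since \<open>\<bar>z - e\<bar> \<le> 1 + \<bar>e\<bar>\<close> on the disc, the divisor makes the function negative on the bidisk.
\<close>

definition pole_ideal_log :: "complex \<Rightarrow> complex \<times> complex \<Rightarrow> ereal" where
  "pole_ideal_log e z = elog (max (max (norm (fst z) * norm (fst z - e)) (norm (snd z) * norm (snd z - e)))
      (norm (fst z) * norm (snd z)) / (1 + norm e))"

text \<open>
  At each centre the value is attained by one of the three products, whose submean inequality
  carries over because the circle mean is monotone.
\<close>

lemma psh_on_pole_ideal_log: "psh_on \<Omega> (pole_ideal_log e)"
proof -
  have k: "1 / (1 + norm e) > 0" and k': "1 + norm e \<noteq> 0"
    by (auto simp: add_pos_nonneg add_nonneg_eq_0_iff)
  have fin: "pole_ideal_log e z < \<infinity>" for z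
    by (auto simp: pole_ideal_log_def elog_def)
  have le: "elog (1 / (1 + norm e) * x * y) \<le> pole_ideal_log e z"
    if "x * y \<le> max (max (norm (fst z) * norm (fst z - e)) (norm (snd z) * norm (snd z - e)))
      (norm (fst z) * norm (snd z))" for x y z
    unfolding pole_ideal_log_def using divide_right_mono[OF that, of "1 + norm e"]
    by (intro elog_mono) auto
  have "subharmonic_on U (\<lambda>\<zeta>. pole_ideal_log e (fst a + \<zeta> * fst b, snd a + \<zeta> * snd b))" for U a b
    unfolding subharmonic_on_def
  proof (intro conjI allI impI ballI)
    show "usc_on U (\<lambda>\<zeta>. pole_ideal_log e (fst a + \<zeta> * fst b, snd a + \<zeta> * snd b))"
      unfolding pole_ideal_log_def by (intro usc_on_elog continuous_intros) (simp add: k')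
  next
    fix c :: complex and r :: real
    define X Y where "X \<zeta> = fst a + \<zeta> * fst b" and "Y \<zeta> = snd a + \<zeta> * snd b" for \<zeta>
    have prod: "elog (1 / (1 + norm e) * norm (p + c * q) * norm (p' + c * q'))
        \<le> circle_mean (\<lambda>\<zeta>. pole_ideal_log e (X \<zeta>, Y \<zeta>)) c r"
      if "\<And>\<zeta>. norm (p + \<zeta> * q) * norm (p' + \<zeta> * q') \<le> max (max (norm (X \<zeta>) * norm (X \<zeta> - e)) (norm (Y \<zeta>) * norm (Y \<zeta> - e)))
      (norm (X \<zeta>) * norm (Y \<zeta>))" for p q p' q'
      by (rule order_trans[OF elog_affine_product_submean[OF k] circle_mean_mono]) (use that le in auto)
    have "elog (1 / (1 + norm e) * norm (X c) * norm (X c - e)) \<le> circle_mean (\<lambda>\<zeta>. pole_ideal_log e (X \<zeta>, Y \<zeta>)) c r"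
      using prod[of "fst a" "fst b" "fst a - e" "fst b"] by (simp add: X_def algebra_simps)
    moreover have "elog (1 / (1 + norm e) * norm (Y c) * norm (Y c - e)) \<le> circle_mean (\<lambda>\<zeta>. pole_ideal_log e (X \<zeta>, Y \<zeta>)) c r"
      using prod[of "snd a" "snd b" "snd a - e" "snd b"] by (simp add: Y_def algebra_simps)
    moreover have "elog (1 / (1 + norm e) * norm (X c) * norm (Y c)) \<le> circle_mean (\<lambda>\<zeta>. pole_ideal_log e (X \<zeta>, Y \<zeta>)) c r"
      using prod[of "fst a" "fst b" "snd a" "snd b"] by (simp add: X_def Y_def)
    ultimately have "pole_ideal_log e (X c, Y c) \<le> circle_mean (\<lambda>\<zeta>. pole_ideal_log e (X \<zeta>, Y \<zeta>)) c r"
      by (simp add: pole_ideal_log_def max_def)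
    then show "pole_ideal_log e (fst a + c * fst b, snd a + c * snd b)
      \<le> circle_mean (\<lambda>\<zeta>. pole_ideal_log e (fst a + \<zeta> * fst b, snd a + \<zeta> * snd b)) c r"
      by (simp add: X_def Y_def)
  qed (rule fin)
  moreover have "usc_on \<Omega> (pole_ideal_log e)"
    unfolding pole_ideal_log_def by (intro usc_on_elog continuous_intros) (simp add: k')
  ultimately show ?thesis
    unfolding psh_on_def using fin by blast
qed

lemma pole_ideal_log_in_green_class:
  assumes e: "norm e < 1"
  shows "pole_ideal_log e \<in> green_class bidisk {(0, 0), (e, 0), (0, e)}"
proof -
  have pos: "1 + norm e > 0" by (simp add: add_pos_nonneg)
  have tri: "norm (z - e) \<le> 1 + norm e" if "norm z < 1" for z
    using norm_triangle_ineq4[of z e] that by simp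
  have prod1: "x * y \<le> y" if "x < 1" "0 \<le> y" for x y :: real
    using mult_right_mono[of x 1 y] that by simp
  have le0: "pole_ideal_log e z \<le> 0" if z: "norm (fst z) < 1" "norm (snd z) < 1" for z
  proof -
    have a: "norm (fst z) * norm (fst z - e) \<le> 1 + norm e"
      using prod1[OF z(1), of "norm (fst z - e)"] tri[OF z(1)] by simp
    have b: "norm (snd z) * norm (snd z - e) \<le> 1 + norm e"
      using prod1[OF z(2), of "norm (snd z - e)"] tri[OF z(2)] by simp
    have c: "norm (fst z) * norm (snd z) \<le> 1 + norm e"
      using prod1[OF z(1) norm_ge_zero[of "snd z"]] z(2) norm_ge_zero[of e] by linarith
    have "pole_ideal_log e z \<le> elog 1"
      unfolding pole_ideal_log_def by (intro elog_mono) (use a b c pos in simp)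
    then show ?thesis by (simp add: elog_def zero_ereal_def)
  qed
  have pole: "pole_ideal_log e z \<le> elog (maxnorm (z - a)) + ereal (ln 2)"
    if z: "norm (fst z) < 1" "norm (snd z) < 1" and a: "a \<in> {(0, 0), (e, 0), (0, e)}" for z a
  proof -
    have t2: "norm (fst z - e) \<le> 2" "norm (snd z - e) \<le> 2"
      using tri[OF z(1)] tri[OF z(2)] e by auto
    have "max (max (norm (fst z) * norm (fst z - e)) (norm (snd z) * norm (snd z - e)))
      (norm (fst z) * norm (snd z)) \<le> 2 * maxnorm (z - a)" (is "?m \<le> _")
    proof -
      have m: "norm (fst (z - a)) \<le> maxnorm (z - a)" "norm (snd (z - a)) \<le> maxnorm (z - a)"
        "0 \<le> maxnorm (z - a)"
        by (auto simp: maxnorm_def le_max_iff_disj)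
      have "norm (fst z) * norm (fst z - e) \<le> 2 * norm (fst z)"
        "norm (snd z) * norm (snd z - e) \<le> 2 * norm (snd z)"
        using mult_left_mono[OF t2(1), of "norm (fst z)"] mult_left_mono[OF t2(2), of "norm (snd z)"] by auto
      moreover have "norm (fst z) * norm (fst z - e) \<le> norm (fst z - e)"
        "norm (snd z) * norm (snd z - e) \<le> norm (snd z - e)"
        "norm (fst z) * norm (snd z) \<le> norm (snd z)"
        "norm (snd z) * norm (fst z) \<le> norm (fst z)"
        using z by (auto intro!: prod1)
      ultimately show ?thesis
        using a m by (auto simp: mult.commute; linarith)
    qed
    moreover have "?m / (1 + norm e) \<le> ?m"
    proof -
      have "?m \<ge> 0" by (simp add: le_max_iff_disj)
      then have "?m * 1 \<le> ?m * (1 + norm e)" by (intro mult_left_mono) auto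
      then show ?thesis using pos by (simp only: pos_divide_le_eq mult_1_right)
    qed
    ultimately have "pole_ideal_log e z \<le> elog (2 * maxnorm (z - a))"
      unfolding pole_ideal_log_def by (intro elog_mono) linarith
    also have "\<dots> \<le> elog (maxnorm (z - a)) + ereal (ln 2)"
      by (auto simp: elog_def ln_mult_pos)
    finally show ?thesis .
  qed
  show ?thesis
    unfolding green_class_def
  proof (intro CollectI conjI ballI exI[of _ "ln 2"])
    show "psh_on bidisk (pole_ideal_log e)" by (rule psh_on_pole_ideal_log)
  qed (auto simp: bidisk_def intro: le0 intro!: pole)
qed

section \<open>Upper semicontinuous functions on compact sets\<close>

lemma usc_on_compose:
  assumes u: "usc_on \<Omega> u" and f: "continuous_on S f" "f ` S \<subseteq> \<Omega>"
  shows "usc_on S (\<lambda>x. u (f x))"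
  unfolding usc_on_def
proof
  fix c
  obtain O' where O': "open O'" "{z \<in> \<Omega>. u z < c} = \<Omega> \<inter> O'"
    using u by (auto simp: usc_on_def openin_open)
  have "{x \<in> S. u (f x) < c} = S \<inter> f -` O'"
    using O' f(2) by auto
  then show "openin (top_of_set S) {x \<in> S. u (f x) < c}"
    using continuous_openin_preimage_gen[OF f(1) O'(1)] by simp
qed

text \<open>
  A real number \<open>q\<close> strictly between the two values splits the inequality into two open conditions,
  and the set is the union over all \<open>q\<close>.
\<close>

lemma openin_usc_less_continuous:
  fixes f :: "'a::topological_space \<Rightarrow> real"
  assumes u: "usc_on S u" and f: "continuous_on S f"
  shows "openin (top_of_set S) {x \<in> S. u x < ereal (f x)}"
proof -
  have "{x \<in> S. u x < ereal (f x)} = (\<Union>q::real. {x \<in> S. u x < ereal q} \<inter> (S \<inter> f -` {q<..}))"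
    (is "?L = ?R")
  proof (intro equalityI subsetI)
    fix x assume "x \<in> ?L"
    then obtain q where "u x < ereal q" "ereal q < ereal (f x)" "x \<in> S"
      using ereal_dense2 by blast
    then show "x \<in> ?R" by auto
  next
    fix x assume "x \<in> ?R"
    then obtain q where "u x < ereal q" "q < f x" "x \<in> S" by auto
    then show "x \<in> ?L" by (auto intro: less_trans)
  qed
  also have "openin (top_of_set S) ?R"
    using u continuous_openin_preimage_gen[OF f]
    by (intro openin_Union ballI) (auto simp: usc_on_def)
  finally show ?thesis .
qed

lemma usc_on_minus_continuous:
  fixes f :: "'a::topological_space \<Rightarrow> real"
  assumes u: "usc_on S u" and f: "continuous_on S f"
  shows "usc_on S (\<lambda>x. u x - ereal (f x))"
  unfolding usc_on_def
proof
  fix c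
  show "openin (top_of_set S) {x \<in> S. u x - ereal (f x) < c}"
  proof (cases c)
    case (real r)
    have "{x \<in> S. u x - ereal (f x) < c} = {x \<in> S. u x < ereal (f x + r)}"
      using real by (auto simp: ereal_minus_less add.commute)
    then show ?thesis
      using openin_usc_less_continuous[OF u continuous_on_add[OF f continuous_on_const]] by simp
  next
    case PInf
    have "u x - ereal (f x) < \<infinity> \<longleftrightarrow> u x < \<infinity>" for x by (cases "u x") auto
    then have "{x \<in> S. u x - ereal (f x) < c} = {x \<in> S. u x < \<infinity>}"
      using PInf by simp
    then show ?thesis using u by (simp only: usc_on_def)
  qed simp
qed

lemma usc_on_compact_attains_max:
  assumes S: "compact S" "S \<noteq> {}" and u: "usc_on S u"
  obtains x where "x \<in> S" "\<And>y. y \<in> S \<Longrightarrow> u y \<le> u x"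
proof (rule ccontr)
  assume no: "\<not> thesis"
  have "\<exists>y\<in>S. u x < u y" if "x \<in> S" for x
    using no that \<open>\<And>x. x \<in> S \<Longrightarrow> (\<And>y. y \<in> S \<Longrightarrow> u y \<le> u x) \<Longrightarrow> thesis\<close> not_le by metis
  moreover have "\<exists>O'. open O' \<and> {x \<in> S. u x < c} = S \<inter> O'" for c
    using u by (auto simp: usc_on_def openin_open)
  then obtain O' where O': "\<And>c. open (O' c)" "\<And>c. {x \<in> S. u x < c} = S \<inter> O' c" by metis
  ultimately have "S \<subseteq> (\<Union>y\<in>S. O' (u y))" by blast
  then obtain T where T: "T \<subseteq> S" "finite T" "S \<subseteq> (\<Union>y\<in>T. O' (u y))"
    using compactE_image[OF S(1), of S "\<lambda>y. O' (u y)"] O'(1) by blast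
  have "T \<noteq> {}" using T S(2) by auto
  then have "Max (u ` T) \<in> u ` T" using T by (intro Max_in) auto
  then obtain x where x: "x \<in> T" "u x = Max (u ` T)" by (metis imageE)
  then obtain y where "y \<in> T" "u x < u y" using T O'(2) by blast
  then show False using x T by (metis Max_ge finite_imageI imageI leD)
qed

lemma compact_tube:
  fixes K :: "'a::heine_borel set" and W :: "('a \<times> 'b::{real_normed_vector, heine_borel}) set"
  assumes "compact K" "open W" "K \<times> {0} \<subseteq> W"
  obtains r where "r > 0" "K \<times> cball 0 r \<subseteq> W"
proof -
  have "\<exists>d>0. \<forall>x\<in>K \<times> {0}. \<forall>y\<in>- W. d \<le> dist x y"
    using assms by (intro separate_compact_closed compact_Times) auto
  then obtain d where d: "d > 0" "\<And>x y. x \<in> K \<times> {0} \<Longrightarrow> y \<notin> W \<Longrightarrow> d \<le> dist x y" by auto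
  have "K \<times> cball 0 (d / 2) \<subseteq> W"
  proof
    fix p assume "p \<in> K \<times> cball (0::'b) (d / 2)"
    then obtain x w where p: "p = (x, w)" "x \<in> K" "norm w \<le> d / 2" by auto
    show "p \<in> W"
    proof (rule ccontr)
      assume "p \<notin> W"
      then have "d \<le> dist (x, 0) p" using d(2) p by auto
      then show False using p d(1) by (simp add: dist_Pair_Pair)
    qed
  qed
  then show thesis using that[of "d / 2"] d(1) by simp
qed

section \<open>Comparison along parabolas\<close>

lemma integral_cis_multiple:
  assumes "n > 0"
  shows "((\<lambda>t. Re (A * cis (real n * t))) has_integral 0) {0..2*pi}"
proof -
  have "((\<lambda>t. cis (real n * t)) has_integral (cis (real n * (2 * pi)) / (\<i> * n) - cis (real n * 0) / (\<i> * n))) {0..2*pi}"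
  proof (rule fundamental_theorem_of_calculus)
    fix t :: real
    have "((\<lambda>z. exp (\<i> * n * z) / (\<i> * n)) has_field_derivative exp (\<i> * n * of_real t)) (at (of_real t))"
      using assms by (auto intro!: derivative_eq_intros)
    from has_vector_derivative_real_field[OF this, of "{0..2*pi}"]
    show "((\<lambda>t. cis (real n * t) / (\<i> * n)) has_vector_derivative cis (real n * t)) (at t within {0..2*pi})"
      by (simp add: cis_conv_exp mult.assoc)
  qed simp
  moreover have "cis (real n * (2 * pi)) = 1"
    using cis_multiple_2pi[of "real n"] by (simp add: mult_ac)
  ultimately have "((\<lambda>t. cis (real n * t)) has_integral 0) {0..2*pi}" by simp
  from has_integral_Re[OF has_integral_mult_right[OF this, of A]] show ?thesis by simp
qed

lemma integral_norm_square_circle: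
  assumes "n > 0"
  shows "((\<lambda>t. (norm (a + b * cis (real n * t)))\<^sup>2) has_integral 2 * pi * ((norm a)\<^sup>2 + (norm b)\<^sup>2)) {0..2*pi}"
proof -
  have "(norm (a + b * cis (real n * t)))\<^sup>2 = ((norm a)\<^sup>2 + (norm b)\<^sup>2) + Re ((2 * cnj a * b) * cis (real n * t))" for t
  proof -
    have "(norm (a + w))\<^sup>2 = (norm a)\<^sup>2 + (norm w)\<^sup>2 + Re (2 * cnj a * w)" for w
      by (simp add: cmod_power2) (simp add: power2_eq_square algebra_simps)
    from this[of "b * cis (real n * t)"] show ?thesis by (simp add: norm_mult mult.assoc)
  qed
  then show ?thesis
    using has_integral_add[OF has_integral_const_real[of "(norm a)\<^sup>2 + (norm b)\<^sup>2" 0 "2*pi"] integral_cis_multiple[OF assms, of "2 * cnj a * b"]]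
    by simp
qed

text \<open>
  The parabola \<open>p + \<zeta> m + \<zeta>\<^sup>2 n\<close>, translated by \<open>w n\<close> in the direction of its axis. Degenerate choices are
  intended: \<open>n = 0\<close> gives a line, for which \<open>w\<close> has no effect.
\<close>

definition parabola :: "complex \<times> complex \<Rightarrow> complex \<times> complex \<Rightarrow> complex \<times> complex \<Rightarrow> complex \<Rightarrow> complex \<Rightarrow> complex \<times> complex" where
  "parabola p m n w \<zeta> = (fst p + \<zeta> * fst m + (\<zeta>\<^sup>2 + w) * fst n, snd p + \<zeta> * snd m + (\<zeta>\<^sup>2 + w) * snd n)"

text \<open>
  In the coordinates \<open>(\<zeta>, w)\<close> the curve \<open>\<tau> \<mapsto> (\<zeta> + \<tau>, w - \<tau>\<^sup>2)\<close> is a complex line in disguise: the quadratic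
  terms of \<open>(\<zeta> + \<tau>)\<^sup>2 + (w - \<tau>\<^sup>2)\<close> cancel. It is the tangent at \<open>\<zeta>\<close> to the parabola translated by \<open>w\<close>,
  and the definition of plurisubharmonicity applies to it.
\<close>

lemma psh_parabola_tangent_submean:
  assumes u: "psh_on \<Omega> u" and r: "r > 0"
    and dom: "\<And>\<tau>. norm \<tau> \<le> r \<Longrightarrow> parabola p m n (w - \<tau>\<^sup>2) (\<zeta> + \<tau>) \<in> \<Omega>"
    and f: "continuous_on {0..2*pi} f" "(f has_integral 2 * pi * I) {0..2*pi}"
    and le: "\<And>t. u (parabola p m n (w - (of_real r * cis t)\<^sup>2) (\<zeta> + of_real r * cis t)) \<le> ereal (f t)"
  shows "u (parabola p m n w \<zeta>) \<le> ereal I"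
proof -
  define a where "a = parabola p m n w \<zeta>"
  define b where "b = (fst m + 2 * \<zeta> * fst n, snd m + 2 * \<zeta> * snd n)"
  have line: "(fst a + \<tau> * fst b, snd a + \<tau> * snd b) = parabola p m n (w - \<tau>\<^sup>2) (\<zeta> + \<tau>)" for \<tau>
    by (simp add: a_def b_def parabola_def power2_eq_square algebra_simps)
  have "subharmonic_on {\<tau>. (fst a + \<tau> * fst b, snd a + \<tau> * snd b) \<in> \<Omega>} (\<lambda>\<tau>. u (fst a + \<tau> * fst b, snd a + \<tau> * snd b))"
    using u by (simp add: psh_on_def)
  then have "subharmonic_on {\<tau>. parabola p m n (w - \<tau>\<^sup>2) (\<zeta> + \<tau>) \<in> \<Omega>} (\<lambda>\<tau>. u (parabola p m n (w - \<tau>\<^sup>2) (\<zeta> + \<tau>)))"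
    unfolding line .
  moreover have "cball 0 r \<subseteq> {\<tau>. parabola p m n (w - \<tau>\<^sup>2) (\<zeta> + \<tau>) \<in> \<Omega>}"
    using dom by auto
  ultimately have "u (parabola p m n (w - 0\<^sup>2) (\<zeta> + 0)) \<le> circle_mean (\<lambda>\<tau>. u (parabola p m n (w - \<tau>\<^sup>2) (\<zeta> + \<tau>))) 0 r"
    unfolding subharmonic_on_def using r by blast
  also have "\<dots> \<le> ereal I"
    using le by (intro circle_mean_le_integral[OF f]) simp
  finally show ?thesis by simp
qed

text \<open>
  The maximum principle for \<open>u\<close> along a parabola against a strictly superharmonic \<open>\<psi>\<close>; \<open>mean\<close> expresses
  that the Laplacian of \<open>\<psi>\<close> is \<open>- 4 \<eta>\<close>. If the conclusion failed, then \<open>u - \<psi> - K \<bar>w\<bar>\<^sup>2\<close> would be positive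
  somewhere on \<open>w = 0\<close>. On a thin tube \<open>\<bar>w\<bar> \<le> s\<close> over \<open>D\<close> it is negative over the boundary of \<open>D\<close> by
  semicontinuity and on \<open>\<bar>w\<bar> = s\<close> by the choice of \<open>K\<close>, so its maximum is attained inside. There the
  submean inequality on the tangent line says that the mean of \<open>\<psi> + K \<bar>w\<bar>\<^sup>2\<close> over a small circle is at
  least its central value, but this mean differs from the central value by \<open>- \<eta> r\<^sup>2 + K r\<^sup>4 < 0\<close>.
\<close>

lemma psh_parabola_strict_comparison:
  fixes \<psi> :: "complex \<Rightarrow> real"
  assumes u: "psh_on \<Omega> u" "\<And>z. z \<in> \<Omega> \<Longrightarrow> u z \<le> 0" and \<Omega>: "open \<Omega>"
    and D: "compact D" "G \<subseteq> D" "open G"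
    and V: "open V" "D \<subseteq> V" "continuous_on V \<psi>"
    and \<eta>: "\<eta> > 0"
    and mean: "\<And>\<zeta> r. r > 0 \<Longrightarrow> cball \<zeta> r \<subseteq> G \<Longrightarrow>
       ((\<lambda>t. \<psi> (\<zeta> + of_real r * cis t)) has_integral 2 * pi * (\<psi> \<zeta> - \<eta> * r\<^sup>2)) {0..2*pi}"
    and dom: "\<And>\<zeta>. \<zeta> \<in> D \<Longrightarrow> parabola p m n 0 \<zeta> \<in> \<Omega>"
    and bd: "\<And>\<zeta>. \<zeta> \<in> D - G \<Longrightarrow> u (parabola p m n 0 \<zeta>) < ereal (\<psi> \<zeta>)"
    and x: "x \<in> D"
  shows "u (parabola p m n 0 x) \<le> ereal (\<psi> x)"
proof (rule ccontr)
  assume neg: "\<not> ?thesis"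
  define F where "F q = parabola p m n (snd q) (fst q)" for q
  have contF: "continuous_on S F" for S
    unfolding F_def parabola_def by (intro continuous_intros)
  have usc: "usc_on \<Omega> u" using u(1) by (simp add: psh_on_def)
  define W where "W = {q \<in> F -` \<Omega> \<inter> (V \<times> UNIV). u (F q) < ereal (\<psi> (fst q))}"
  have opF: "open (F -` \<Omega>)" using \<Omega> contF by (rule open_vimage)
  have "open (F -` \<Omega> \<inter> (V \<times> UNIV))" using opF V by (intro open_Int open_Times) auto
  moreover have "openin (top_of_set (F -` \<Omega> \<inter> (V \<times> UNIV))) W"
    unfolding W_def
    by (intro openin_usc_less_continuous usc_on_compose[OF usc contF]
        continuous_on_compose2[OF V(3) continuous_on_fst[OF continuous_on_id]]) auto
  ultimately have "open W" using openin_open_trans by blast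
  have "compact (D - G)" using D by (intro compact_diff) auto
  moreover have "(D - G) \<times> {0} \<subseteq> W"
    using bd dom V by (auto simp: W_def F_def)
  ultimately obtain r1 where r1: "r1 > 0" "(D - G) \<times> cball 0 r1 \<subseteq> W"
    using \<open>open W\<close> by (metis compact_tube)
  have "D \<times> {0} \<subseteq> F -` \<Omega>" using dom by (auto simp: F_def)
  then obtain r2 where r2: "r2 > 0" "D \<times> cball 0 r2 \<subseteq> F -` \<Omega>"
    using compact_tube[OF D(1) opF] by metis
  define s where "s = min r1 r2"
  have s: "s > 0" "(D - G) \<times> cball 0 s \<subseteq> W" "D \<times> cball 0 s \<subseteq> F -` \<Omega>"
    using r1 r2 by (fastforce simp: s_def)+
  have cont\<psi>: "continuous_on D \<psi>" using V continuous_on_subset by blast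
  have "bounded (\<psi> ` D)" using D(1) cont\<psi> compact_continuous_image compact_imp_bounded by blast
  then obtain B where B: "\<And>\<zeta>. \<zeta> \<in> D \<Longrightarrow> \<bar>\<psi> \<zeta>\<bar> \<le> B" by (auto simp: bounded_iff)
  \<comment> \<open>large enough to make the penalised function negative on \<open>\<bar>w\<bar> = s\<close>\<close>
  define K where "K = (B + 1) / s\<^sup>2"
  have "B \<ge> 0" using B[OF x] by linarith
  then have K: "K > 0" "K * s\<^sup>2 = B + 1" using s by (auto simp: K_def)
  define P where "P q = \<psi> (fst q) + K * (norm (snd q))\<^sup>2" for q :: "complex \<times> complex"
  define v where "v q = u (F q) - ereal (P q)" for q
  let ?E = "D \<times> cball (0::complex) s"
  have contP: "continuous_on ?E P"
    unfolding P_def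
    by (intro continuous_intros continuous_on_compose2[OF cont\<psi> continuous_on_fst[OF continuous_on_id]]) auto
  have "usc_on ?E v"
    unfolding v_def
    by (intro usc_on_minus_continuous usc_on_compose[OF usc contF] contP) (use s(3) in auto)
  moreover have "compact ?E" using D(1) by (intro compact_Times) auto
  moreover have "(x, 0) \<in> ?E" using x s(1) by auto
  ultimately obtain q where q: "q \<in> ?E" "\<And>q'. q' \<in> ?E \<Longrightarrow> v q' \<le> v q"
    using usc_on_compact_attains_max[of ?E v] by (metis empty_iff)
  obtain \<zeta> w where qw: "q = (\<zeta>, w)" by force
  have "u (F (x, 0)) > ereal (\<psi> x)" using neg by (simp add: F_def)
  then have "v (x, 0) > 0"
    by (cases "u (F (x, 0))") (auto simp: v_def P_def)
  then have vq: "v q > 0" using q(2)[OF \<open>(x, 0) \<in> ?E\<close>] by simp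
  have Fq: "F q \<in> \<Omega>" using q(1) s(3) by auto
  obtain U where U: "u (F q) = ereal U"
    using vq u(2)[OF Fq] by (cases "u (F q)") (auto simp: v_def)
  have U0: "U \<le> 0" "U > P q" using u(2)[OF Fq] vq by (auto simp: U v_def)
  have D\<zeta>: "\<zeta> \<in> D" "norm w \<le> s" using q(1) qw by auto
  have "norm w < s"
  proof (rule ccontr)
    assume "\<not> norm w < s"
    then have "norm w = s" using D\<zeta> by simp
    then have "P q = \<psi> \<zeta> + (B + 1)" using K by (simp add: P_def qw)
    then show False using B[OF D\<zeta>(1)] U0 by linarith
  qed
  have "\<zeta> \<in> G"
  proof (rule ccontr)
    assume "\<zeta> \<notin> G"
    then have "q \<in> W" using s(2) D\<zeta> qw by auto
    then have "U < \<psi> \<zeta>" using U by (simp add: W_def qw)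
    moreover have "P q \<ge> \<psi> \<zeta>" using K by (simp add: P_def qw)
    ultimately show False using U0 by linarith
  qed
  then obtain e where e: "e > 0" "cball \<zeta> e \<subseteq> G" using D(3) open_contains_cball by blast
  have "\<forall>\<^sub>F r in at_right 0. r \<le> e \<and> norm w + r\<^sup>2 \<le> s \<and> K * r\<^sup>2 < \<eta> \<and> r > 0"
  proof (intro eventually_conj)
    have "((\<lambda>r. norm w + r\<^sup>2) \<longlongrightarrow> norm w + 0\<^sup>2) (at_right 0)"
      by (intro tendsto_intros)
    from order_tendstoD(2)[OF this, of s] show "\<forall>\<^sub>F r in at_right 0. norm w + r\<^sup>2 \<le> s"
      using \<open>norm w < s\<close> by (auto elim!: eventually_mono)
    have "((\<lambda>r. K * r\<^sup>2) \<longlongrightarrow> K * 0\<^sup>2) (at_right 0)"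
      by (intro tendsto_intros)
    from order_tendstoD(2)[OF this, of \<eta>] show "\<forall>\<^sub>F r in at_right 0. K * r\<^sup>2 < \<eta>"
      using \<eta> by simp
    show "\<forall>\<^sub>F r in at_right 0. r \<le> e" using e(1)
      by (metis eventually_at_right_field less_imp_le)
    show "\<forall>\<^sub>F r::real in at_right 0. r > 0" by (rule eventually_at_right_less)
  qed
  then obtain r where r: "r > 0" "r \<le> e" "norm w + r\<^sup>2 \<le> s" "K * r\<^sup>2 < \<eta>"
    using eventually_happens'[OF trivial_limit_at_right_real] by blast
  have E: "(\<zeta> + \<tau>, w - \<tau>\<^sup>2) \<in> ?E" if "norm \<tau> \<le> r" for \<tau>
  proof -
    have "\<zeta> + \<tau> \<in> cball \<zeta> e" using that r by (simp add: dist_norm)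
    then have "\<zeta> + \<tau> \<in> D" using e(2) D(2) by blast
    moreover have "norm (w - \<tau>\<^sup>2) \<le> norm w + (norm \<tau>)\<^sup>2"
      using norm_triangle_ineq4[of w "\<tau>\<^sup>2"] by (simp add: norm_power)
    moreover have "(norm \<tau>)\<^sup>2 \<le> r\<^sup>2" using that by (intro power_mono) auto
    ultimately show ?thesis using r(3) by simp
  qed
  \<comment> \<open>the bound for \<open>u\<close> on the circle that maximality at \<open>q\<close> implies\<close>
  define f where "f t = (\<psi> (\<zeta> + of_real r * cis t) + K * (norm (w + (- (of_real r)\<^sup>2) * cis (real 2 * t)))\<^sup>2) + (U - P q)" for t
  have sq: "(of_real r * cis t)\<^sup>2 = (of_real r)\<^sup>2 * cis (2 * t)" for t
    by (simp add: power_mult_distrib power2_eq_square cis_mult)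
  have nc: "norm (of_real r * cis t) \<le> r" for t using r(1) by (simp add: norm_mult)
  have "cball \<zeta> r \<subseteq> G" using e(2) r(2) by auto
  have "u (parabola p m n w \<zeta>) \<le> ereal (U - (\<eta> - K * r\<^sup>2) * r\<^sup>2)"
  proof (rule psh_parabola_tangent_submean[OF u(1) r(1), where f = f])
    show "parabola p m n (w - \<tau>\<^sup>2) (\<zeta> + \<tau>) \<in> \<Omega>" if "norm \<tau> \<le> r" for \<tau>
      using subsetD[OF s(3) E[OF that]] by (simp add: F_def)
    show "continuous_on {0..2*pi} f"
      unfolding f_def using E[OF nc]
      by (intro continuous_intros continuous_on_compose2[OF cont\<psi>]) auto
    show "u (parabola p m n (w - (of_real r * cis t)\<^sup>2) (\<zeta> + of_real r * cis t)) \<le> ereal (f t)" for t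
    proof -
      let ?q = "(\<zeta> + of_real r * cis t, w - (of_real r * cis t)\<^sup>2)"
      have "v ?q \<le> v q" by (intro q(2) E nc)
      then have "u (F ?q) \<le> ereal (P ?q + (U - P q))"
        unfolding v_def U by (cases "u (F ?q)") auto
      also have "P ?q + (U - P q) = f t" by (simp add: f_def P_def sq)
      finally show ?thesis by (simp add: F_def)
    qed
    have "(f has_integral ((2 * pi * (\<psi> \<zeta> - \<eta> * r\<^sup>2)
        + K * (2 * pi * ((norm w)\<^sup>2 + (norm (- (complex_of_real r)\<^sup>2))\<^sup>2))) + 2 * pi * (U - P q))) {0..2*pi}"
      unfolding f_def
      using has_integral_const_real[of "U - P q" 0 "2*pi"]
      by (intro has_integral_add has_integral_mult_right mean[OF r(1) \<open>cball \<zeta> r \<subseteq> G\<close>]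
           integral_norm_square_circle) auto
    then show "(f has_integral 2 * pi * (U - (\<eta> - K * r\<^sup>2) * r\<^sup>2)) {0..2*pi}"
      by (rule has_integral_eq_rhs)
         (use r(1) in \<open>simp add: P_def qw norm_mult algebra_simps power2_eq_square\<close>)
  qed
  then have "(\<eta> - K * r\<^sup>2) * r\<^sup>2 \<le> 0" using U by (simp add: F_def qw)
  moreover have "(\<eta> - K * r\<^sup>2) * r\<^sup>2 > 0" using r by (intro mult_pos_pos) auto
  ultimately show False by simp
qed

section \<open>Upper bounds for the Green function\<close>

text \<open>
  The right-hand side \<open>h\<close> is harmonic off \<open>Z\<close>, and it is nonnegative for \<open>\<bar>\<zeta>\<bar> = R\<close> because
  \<open>\<bar>\<zeta> - z\<bar> \<ge> R - \<bar>z\<bar>\<close> there. The strict comparison is applied to \<open>(1 - \<eta>) h + \<eta> (R\<^sup>2 + 1 - \<bar>\<zeta>\<bar>\<^sup>2)\<close>: the factor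
  \<open>1 - \<eta>\<close> makes its poles weaker than those of \<open>u\<close>, so that the comparison holds near \<open>Z\<close>; the other
  summand makes it strictly superharmonic and positive on the boundary. Then \<open>\<eta>\<close> tends to 0.
\<close>

lemma green_class_parabola_bound:
  assumes u: "u \<in> green_class bidisk A" and R: "R > 0"
    and Z: "finite Z" "Z \<subseteq> ball 0 R" "\<And>z. z \<in> Z \<Longrightarrow> parabola p m n 0 z \<in> A"
    and dom: "\<And>\<zeta>. norm \<zeta> \<le> R \<Longrightarrow> parabola p m n 0 \<zeta> \<in> bidisk"
    and x: "norm x \<le> R" "x \<notin> Z"
  shows "u (parabola p m n 0 x) \<le> ereal (\<Sum>z\<in>Z. ln (norm (x - z)) - ln (R - norm z))"
proof -
  have psh: "psh_on bidisk u" and neg: "\<And>z. z \<in> bidisk \<Longrightarrow> u z \<le> 0"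
    using u by (auto simp: green_class_def)
  define h where "h \<zeta> = (\<Sum>z\<in>Z. ln (norm (\<zeta> - z)) - ln (R - norm z))" for \<zeta>
  define \<psi> where "\<psi> \<eta> \<zeta> = (1 - \<eta>) * h \<zeta> + \<eta> * (R\<^sup>2 + 1 - (norm \<zeta>)\<^sup>2)" for \<eta> \<zeta>
  have bound: "u (parabola p m n 0 x) \<le> ereal (\<psi> \<eta> x)" if \<eta>: "0 < \<eta>" "\<eta> < 1" for \<eta>
  proof -
    \<comment> \<open>near a pole \<open>u \<circ> \<phi> - \<psi>\<close> is at most \<open>\<eta> ln \<bar>\<zeta> - z\<bar>\<close> up to a bounded term\<close>
    have near: "\<forall>\<^sub>F \<zeta> in at z. norm \<zeta> \<le> R \<longrightarrow> u (parabola p m n 0 \<zeta>) < ereal (\<psi> \<eta> \<zeta>)" if z: "z \<in> Z" for z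
    proof -
      obtain C where C: "\<And>w. w \<in> bidisk \<Longrightarrow> u w \<le> elog (maxnorm (w - parabola p m n 0 z)) + ereal C"
        using u Z(3)[OF z] unfolding green_class_def by blast
      \<comment> \<open>a Lipschitz constant of the parabola on \<open>cball 0 R\<close> in the maximum norm\<close>
      define B where "B = norm (fst m) + norm (snd m) + 2 * R * (norm (fst n) + norm (snd n)) + 1"
      have B: "B > 0" using R by (simp add: B_def add_nonneg_pos)
      have zR: "norm z \<le> R" using z Z(2) by auto
      \<comment> \<open>what remains of \<open>\<psi>\<close> without its logarithmic pole at \<open>z\<close>; continuous at \<open>z\<close>\<close>
      define \<kappa> where "\<kappa> \<zeta> = (1 - \<eta>) * ((\<Sum>y\<in>Z - {z}. ln (norm (\<zeta> - y)) - ln (R - norm y)) - ln (R - norm z))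
          + \<eta> * (R\<^sup>2 + 1 - (norm \<zeta>)\<^sup>2)" for \<zeta>
      have \<psi>\<kappa>: "\<psi> \<eta> \<zeta> = (1 - \<eta>) * ln (norm (\<zeta> - z)) + \<kappa> \<zeta>" for \<zeta>
        unfolding \<psi>_def h_def \<kappa>_def using Z(1) z by (simp add: sum.remove algebra_simps)
      have "(\<kappa> \<longlongrightarrow> \<kappa> z) (at z)"
        unfolding \<kappa>_def by (intro tendsto_intros) auto
      then have k: "\<forall>\<^sub>F \<zeta> in at z. \<kappa> \<zeta> > \<kappa> z - 1"
        by (rule order_tendstoD) simp
      have "((\<lambda>\<zeta>. norm (\<zeta> - z)) \<longlongrightarrow> norm (z - z)) (at z)"
        by (intro tendsto_intros)
      then have "((\<lambda>\<zeta>. norm (\<zeta> - z)) \<longlongrightarrow> 0) (at z)" by simp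
      then have e: "\<forall>\<^sub>F \<zeta> in at z. norm (\<zeta> - z) < exp ((\<kappa> z - 1 - ln B - C) / \<eta>)"
        by (rule order_tendstoD) simp
      have ne: "\<forall>\<^sub>F \<zeta> in at z. \<zeta> \<noteq> z" by (simp add: eventually_at_filter)
      show ?thesis
        using k e ne
      proof eventually_elim
        case (elim \<zeta>)
        show ?case
        proof
          assume \<zeta>R: "norm \<zeta> \<le> R"
          have pos: "norm (\<zeta> - z) > 0" using elim(3) by simp
          have "ln (norm (\<zeta> - z)) < (\<kappa> z - 1 - ln B - C) / \<eta>"
            using elim(2) pos by (metis exp_less_cancel_iff exp_ln)
          then have small: "\<eta> * ln (norm (\<zeta> - z)) < \<kappa> z - 1 - ln B - C"
            using \<eta> by (simp add: pos_less_divide_eq mult.commute)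
          have coord: "norm ((\<zeta> - z) * (c + (\<zeta> + z) * d)) \<le> norm (\<zeta> - z) * B"
            if "norm c + 2 * R * norm d \<le> B" for c d
          proof -
            have "norm (\<zeta> + z) \<le> 2 * R"
              using norm_triangle_ineq[of \<zeta> z] zR \<zeta>R by linarith
            then have "norm ((\<zeta> + z) * d) \<le> 2 * R * norm d"
              unfolding norm_mult by (intro mult_right_mono) auto
            then have "norm (c + (\<zeta> + z) * d) \<le> B"
              using norm_triangle_ineq[of c "(\<zeta> + z) * d"] that by linarith
            then show ?thesis unfolding norm_mult by (intro mult_left_mono) auto
          qed
          have "parabola p m n 0 \<zeta> - parabola p m n 0 z
              = ((\<zeta> - z) * (fst m + (\<zeta> + z) * fst n), (\<zeta> - z) * (snd m + (\<zeta> + z) * snd n))"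
            by (simp add: parabola_def algebra_simps power2_eq_square)
          moreover have "norm (fst m) + 2 * R * norm (fst n) \<le> B" "norm (snd m) + 2 * R * norm (snd n) \<le> B"
            using R by (simp_all add: B_def distrib_left add_nonneg_nonneg)
          ultimately have "maxnorm (parabola p m n 0 \<zeta> - parabola p m n 0 z) \<le> norm (\<zeta> - z) * B"
            using coord by (simp add: maxnorm_def)
          then have "elog (maxnorm (parabola p m n 0 \<zeta> - parabola p m n 0 z)) \<le> elog (norm (\<zeta> - z) * B)"
            by (rule elog_mono)
          also have "\<dots> = ereal (ln (norm (\<zeta> - z)) + ln B)"
            using pos B by (simp add: elog_def ln_mult_pos mult_le_0_iff)
          finally have "u (parabola p m n 0 \<zeta>) \<le> ereal (ln (norm (\<zeta> - z)) + ln B) + ereal C"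
            using C[OF dom[OF \<zeta>R]] by (meson add_right_mono order_trans)
          also have "\<dots> < ereal (\<psi> \<eta> \<zeta>)"
            unfolding \<psi>\<kappa> using small elim(1) by (simp add: algebra_simps)
          finally show "u (parabola p m n 0 \<zeta>) < ereal (\<psi> \<eta> \<zeta>)" .
        qed
      qed
    qed
    have "\<forall>\<^sub>F s in at_right 0. \<forall>z\<in>Z. s \<le> norm (x - z) \<and>
        (\<forall>\<zeta>. norm \<zeta> \<le> R \<longrightarrow> norm (\<zeta> - z) = s \<longrightarrow> u (parabola p m n 0 \<zeta>) < ereal (\<psi> \<eta> \<zeta>))"
    proof (intro eventually_ball_finite Z(1) ballI eventually_conj)
      fix z assume z: "z \<in> Z"
      show "\<forall>\<^sub>F s in at_right 0. s \<le> norm (x - z)"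
      proof -
        have "0 < norm (x - z)" using x(2) z by auto
        from eventually_at_right_real[OF this] show ?thesis
          by (rule eventually_mono) auto
      qed
      obtain d where "d > 0" "\<And>\<zeta>. \<zeta> \<noteq> z \<Longrightarrow> dist \<zeta> z < d \<Longrightarrow> norm \<zeta> \<le> R \<Longrightarrow> u (parabola p m n 0 \<zeta>) < ereal (\<psi> \<eta> \<zeta>)"
        using near[OF z] unfolding eventually_at by auto
      then show "\<forall>\<^sub>F s in at_right 0. \<forall>\<zeta>. norm \<zeta> \<le> R \<longrightarrow> norm (\<zeta> - z) = s \<longrightarrow> u (parabola p m n 0 \<zeta>) < ereal (\<psi> \<eta> \<zeta>)"
        unfolding eventually_at_right_field by (intro exI[of _ d]) (auto simp: dist_norm)
    qed
    then have "\<forall>\<^sub>F s in at_right 0. s > 0 \<and> (\<forall>z\<in>Z. s \<le> norm (x - z) \<and>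
        (\<forall>\<zeta>. norm \<zeta> \<le> R \<longrightarrow> norm (\<zeta> - z) = s \<longrightarrow> u (parabola p m n 0 \<zeta>) < ereal (\<psi> \<eta> \<zeta>)))"
      by (intro eventually_conj eventually_at_right_less)
    then obtain s where s: "s > 0" "\<And>z. z \<in> Z \<Longrightarrow> s \<le> norm (x - z)"
       "\<And>z \<zeta>. z \<in> Z \<Longrightarrow> norm \<zeta> \<le> R \<Longrightarrow> norm (\<zeta> - z) = s \<Longrightarrow> u (parabola p m n 0 \<zeta>) < ereal (\<psi> \<eta> \<zeta>)"
      using eventually_happens'[OF trivial_limit_at_right_real] by blast
    \<comment> \<open>the discs of radius \<open>s\<close> around the poles are cut out, where the comparison is already known\<close>
    define D where "D = cball 0 R - (\<Union>z\<in>Z. ball z s)"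
    define G where "G = ball 0 R - (\<Union>z\<in>Z. cball z s)"
    show ?thesis
    proof (rule psh_parabola_strict_comparison[where D = D and G = G and V = "- Z" and \<eta> = \<eta>])
      show "compact D" unfolding D_def by (intro compact_diff compact_cball open_UN ballI open_ball)
      show "open G" unfolding G_def using Z(1) by (intro open_Diff open_ball closed_UN ballI closed_cball)
      show "G \<subseteq> D" by (force simp: G_def D_def)
      show "open (- Z)" using Z(1) by (simp add: finite_imp_closed open_Compl)
      show "D \<subseteq> - Z" using s(1) by (auto simp: D_def)
      show "continuous_on (- Z) (\<psi> \<eta>)"
        unfolding \<psi>_def h_def by (intro continuous_intros) auto
      show "x \<in> D" using x s(2) by (force simp: D_def dist_norm norm_minus_commute)
      show "open bidisk" unfolding bidisk_def by (intro open_Times open_ball)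
      show "parabola p m n 0 \<zeta> \<in> bidisk" if "\<zeta> \<in> D" for \<zeta> using that dom by (auto simp: D_def)
      show "u (parabola p m n 0 \<zeta>) < ereal (\<psi> \<eta> \<zeta>)" if \<zeta>: "\<zeta> \<in> D - G" for \<zeta>
      proof -
        have "norm \<zeta> \<le> R" using \<zeta> by (auto simp: D_def)
        consider "norm \<zeta> = R" | z where "z \<in> Z" "norm (\<zeta> - z) = s"
          using \<zeta> by (fastforce simp: D_def G_def dist_norm norm_minus_commute)
        then show ?thesis
        proof cases
          case 1
          have "h \<zeta> \<ge> 0" unfolding h_def
          proof (intro sum_nonneg)
            fix z assume "z \<in> Z"
            then have "norm z < R" using Z(2) by auto
            moreover have "R - norm z \<le> norm (\<zeta> - z)" using norm_triangle_ineq2[of \<zeta> z] 1 by simp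
            ultimately show "0 \<le> ln (norm (\<zeta> - z)) - ln (R - norm z)" using ln_mono[of "R - norm z" "norm (\<zeta> - z)"] by simp
          qed
          then have "\<psi> \<eta> \<zeta> > 0" using \<eta> 1 by (simp add: \<psi>_def add_nonneg_pos)
          moreover have "u (parabola p m n 0 \<zeta>) \<le> 0" by (rule neg[OF dom[OF \<open>norm \<zeta> \<le> R\<close>]])
          ultimately show ?thesis by (metis ereal_less(2) le_less_trans)
        next
          case 2
          then show ?thesis using s(3) \<open>norm \<zeta> \<le> R\<close> by blast
        qed
      qed
      show "((\<lambda>t. \<psi> \<eta> (\<zeta> + of_real r * cis t)) has_integral 2 * pi * (\<psi> \<eta> \<zeta> - \<eta> * r\<^sup>2)) {0..2*pi}"
        if r: "r > 0" "cball \<zeta> r \<subseteq> G" for \<zeta> r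
      proof -
        have far: "norm (complex_of_real r) < norm (\<zeta> - z)" if z: "z \<in> Z" for z
        proof (rule ccontr)
          assume "\<not> ?thesis"
          then have "z \<in> cball \<zeta> r" using r(1) by (simp add: dist_norm)
          then have "z \<in> G" using r(2) by blast
          then show False using z s(1) by (auto simp: G_def)
        qed
        have log: "((\<lambda>t. ln (norm (\<zeta> + of_real r * cis t - z)) - ln (R - norm z))
            has_integral 2 * pi * (ln (norm (\<zeta> - z)) - ln (R - norm z))) {0..2*pi}" if z: "z \<in> Z" for z
          using has_integral_diff[OF integral_ln_norm_affine[OF far[OF z]] has_integral_const_real[of "ln (R - norm z)" 0 "2*pi"]]
          by (simp add: algebra_simps)
        have sq: "((\<lambda>t. (norm (\<zeta> + of_real r * cis t))\<^sup>2) has_integral 2 * pi * ((norm \<zeta>)\<^sup>2 + r\<^sup>2)) {0..2*pi}"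
          using integral_norm_square_circle[of 1 \<zeta> "of_real r"] by simp
        have "((\<lambda>t. \<psi> \<eta> (\<zeta> + of_real r * cis t)) has_integral
            (1 - \<eta>) * (\<Sum>z\<in>Z. 2 * pi * (ln (norm (\<zeta> - z)) - ln (R - norm z)))
            + \<eta> * (2 * pi * (R\<^sup>2 + 1) - 2 * pi * ((norm \<zeta>)\<^sup>2 + r\<^sup>2))) {0..2*pi}"
          unfolding \<psi>_def h_def
          using has_integral_const_real[of "R\<^sup>2 + 1" 0 "2*pi"]
          by (intro has_integral_add has_integral_mult_right has_integral_sum Z(1) log has_integral_diff sq) auto
        then show ?thesis
          by (rule has_integral_eq_rhs) (simp only: \<psi>_def h_def sum_distrib_left[symmetric]; simp add: algebra_simps)
      qed
    qed (use psh neg \<eta> in auto)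
  qed
  have "((\<lambda>\<eta>. ereal (\<psi> \<eta> x)) \<longlongrightarrow> ereal (\<psi> 0 x)) (at_right 0)"
    unfolding \<psi>_def lim_ereal by (intro tendsto_intros)
  moreover have "\<forall>\<^sub>F \<eta>::real in at_right 0. \<eta> \<in> {0<..<1}" by (rule eventually_at_right_real) simp
  then have "\<forall>\<^sub>F \<eta> in at_right 0. u (parabola p m n 0 x) \<le> ereal (\<psi> \<eta> x)"
    by (rule eventually_mono) (use bound in auto)
  ultimately have "u (parabola p m n 0 x) \<le> ereal (\<psi> 0 x)"
    by (intro tendsto_lowerbound) auto
  then show ?thesis by (simp add: \<psi>_def h_def)
qed

text \<open>
  The form in which the comparison is used: the curves and the parameters \<open>\<sigma> j k\<close> of the poles vary
  with \<open>k\<close>, the point \<open>z\<close> and its parameter \<open>x\<close> do not, so that pointwise convergence at \<open>z\<close> is enough.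
\<close>

lemma green_parabola_limit_bound:
  assumes lim: "(\<lambda>k. green bidisk (A k) z) \<longlonglongrightarrow> L"
    and x: "x \<noteq> 0" "norm x \<le> R"
    and \<sigma>: "\<And>j. j < N \<Longrightarrow> (\<lambda>k. \<sigma> j k) \<longlonglongrightarrow> 0"
    and dom: "\<forall>\<^sub>F k in sequentially. \<forall>\<zeta>. norm \<zeta> \<le> R \<longrightarrow> parabola (p k) (m k) (n k) 0 \<zeta> \<in> bidisk"
    and thr: "\<forall>\<^sub>F k in sequentially. parabola (p k) (m k) (n k) 0 x = z"
    and poles: "\<And>j. j < N \<Longrightarrow> \<forall>\<^sub>F k in sequentially. parabola (p k) (m k) (n k) 0 (\<sigma> j k) \<in> A k"
    and inj: "\<forall>\<^sub>F k in sequentially. inj_on (\<lambda>j. \<sigma> j k) {..<N}"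
  shows "L \<le> ereal (real N * (ln (norm x) - ln R))"
proof -
  have R: "R > 0" using x by (meson less_le_trans zero_less_norm_iff)
  have ev: "\<forall>\<^sub>F k in sequentially. norm (\<sigma> j k) < R \<and> \<sigma> j k \<noteq> x \<and> parabola (p k) (m k) (n k) 0 (\<sigma> j k) \<in> A k"
    if j: "j < N" for j
  proof (intro eventually_conj poles[OF j])
    show "\<forall>\<^sub>F k in sequentially. norm (\<sigma> j k) < R"
      using order_tendstoD(2)[OF tendsto_norm[OF \<sigma>[OF j]]] R by simp
    show "\<forall>\<^sub>F k in sequentially. \<sigma> j k \<noteq> x"
      using tendsto_imp_eventually_ne[OF \<sigma>[OF j]] x by auto
  qed
  have ev: "\<forall>\<^sub>F k in sequentially. \<forall>j\<in>{..<N}. norm (\<sigma> j k) < R \<and> \<sigma> j k \<noteq> x \<and> parabola (p k) (m k) (n k) 0 (\<sigma> j k) \<in> A k"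
    using ev by (intro eventually_ball_finite) auto
  have "\<forall>\<^sub>F k in sequentially. green bidisk (A k) z \<le> ereal (\<Sum>j<N. ln (norm (x - \<sigma> j k)) - ln (R - norm (\<sigma> j k)))"
    using dom thr inj ev
  proof eventually_elim
    case (elim k)
    have "u (parabola (p k) (m k) (n k) 0 x) \<le> ereal (\<Sum>y\<in>(\<lambda>j. \<sigma> j k) ` {..<N}. ln (norm (x - y)) - ln (R - norm y))"
      if "u \<in> green_class bidisk (A k)" for u
      by (rule green_class_parabola_bound[OF that R]) (use elim x in auto)
    then show ?case
      unfolding green_def using elim(2,3) by (intro SUP_least) (simp add: sum.reindex)
  qed
  moreover have "(\<lambda>k. \<Sum>j<N. ln (norm (x - \<sigma> j k)) - ln (R - norm (\<sigma> j k))) \<longlonglongrightarrow> (\<Sum>j<N. ln (norm (x - 0)) - ln (R - norm (0::complex)))"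
    using x R by (intro tendsto_intros \<sigma>) auto
  then have "(\<lambda>k. ereal (\<Sum>j<N. ln (norm (x - \<sigma> j k)) - ln (R - norm (\<sigma> j k)))) \<longlonglongrightarrow> ereal (real N * (ln (norm x) - ln R))"
    by simp
  ultimately show ?thesis
    by (intro tendsto_le[OF _ _ lim]) auto
qed

lemma ereal_le_radius_limit:
  assumes "0 \<le> a" "a < R0" and le: "\<And>R. a < R \<Longrightarrow> R < R0 \<Longrightarrow> L \<le> ereal (N * (c - ln R))"
  shows "L \<le> ereal (N * (c - ln R0))"
proof -
  have "((\<lambda>R. ereal (N * (c - ln R))) \<longlongrightarrow> ereal (N * (c - ln R0))) (at_left R0)"
    unfolding lim_ereal using assms by (intro tendsto_intros) auto
  moreover have "\<forall>\<^sub>F R in at_left R0. R \<in> {a<..<R0}" using assms by (intro eventually_at_left_real)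
  then have "\<forall>\<^sub>F R in at_left R0. L \<le> ereal (N * (c - ln R))"
    by (rule eventually_mono) (use le in auto)
  ultimately show ?thesis by (intro tendsto_lowerbound) auto
qed

text \<open>
  Every competitor equals \<open>-\<infinity>\<close> at a pole, as \<open>elog 0 = -\<infinity>\<close> absorbs the constant.
\<close>

lemma green_at_pole:
  assumes "a \<in> A" "a \<in> \<Omega>"
  shows "green \<Omega> A a = -\<infinity>"
proof -
  have "u a \<le> -\<infinity>" if u: "u \<in> green_class \<Omega> A" for u
  proof -
    obtain C where "\<And>w. w \<in> \<Omega> \<Longrightarrow> u w \<le> elog (maxnorm (w - a)) + ereal C"
      using u assms unfolding green_class_def by blast
    from this[OF assms(2)] show ?thesis by (simp add: maxnorm_def elog_def)
  qed
  then show ?thesis unfolding green_def by (simp add: SUP_eq_iff bot_ereal_def[symmetric] le_bot)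
qed

section \<open>Parabolas through the poles\<close>

text \<open>
  With \<open>z = (z1, z2)\<close> at parameter 1 and the pole \<open>(0, 0)\<close> at parameter 0, a parabola with poles
  \<open>(e, 0)\<close> at \<open>\<alpha>\<close> and \<open>(0, e)\<close> at \<open>\<beta>\<close> has the coordinates \<open>z1 \<zeta> (\<zeta> - \<beta>) / (1 - \<beta>)\<close> and
  \<open>z2 \<zeta> (\<zeta> - \<alpha>) / (1 - \<alpha>)\<close>. That it meets the two poles is the conclusion. It follows from the symmetric
  system \<open>z1 \<alpha> + z2 \<beta> = e\<close>, \<open>z1 \<alpha>\<^sup>2 + z2 \<beta>\<^sup>2 = e\<close>; eliminating \<open>\<beta>\<close> leaves a quadratic equation for \<open>\<alpha>\<close> with
  a quarter of its discriminant equal to \<open>S\<^sup>2\<close>.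
\<close>

lemma three_pole_parameters:
  fixes z1 z2 e \<alpha> \<beta> S :: complex
  assumes nz: "z1 \<noteq> 0" "z2 \<noteq> 0" "z1 + z2 \<noteq> 0"
    and S: "S\<^sup>2 = e * z1 * z2 * (z1 + z2 - e)"
    and \<alpha>: "\<alpha> = (e * z1 + S) / (z1 * (z1 + z2))"
    and \<beta>: "\<beta> = (e - z1 * \<alpha>) / z2"
  shows "z1 * \<alpha> * (\<alpha> - \<beta>) = e * (1 - \<beta>)" "z2 * \<beta> * (\<beta> - \<alpha>) = e * (1 - \<alpha>)"
proof -
  have lin: "z1 * \<alpha> + z2 * \<beta> = e" using nz by (simp add: \<beta>)
  have q: "z1 * (z1 + z2) * \<alpha> = e * z1 + S" using nz by (simp add: \<alpha>)
  have "z1 * (z1 + z2) * z2 * (z1 * \<alpha>\<^sup>2 + z2 * \<beta>\<^sup>2)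
      = z1 * (z1 + z2) * (z1 * z2 * \<alpha>\<^sup>2 + (z2 * \<beta>)\<^sup>2)"
    by (simp add: power2_eq_square algebra_simps)
  also have "z2 * \<beta> = e - z1 * \<alpha>" using lin by (simp add: algebra_simps)
  also have "z1 * (z1 + z2) * (z1 * z2 * \<alpha>\<^sup>2 + (e - z1 * \<alpha>)\<^sup>2)
      = (z1 * (z1 + z2) * \<alpha>)\<^sup>2 - 2 * e * z1 * (z1 * (z1 + z2) * \<alpha>) + e\<^sup>2 * (z1 * (z1 + z2))"
    by (simp add: power2_eq_square algebra_simps)
  also have "\<dots> = S\<^sup>2 + e\<^sup>2 * z1 * z2"
    unfolding q by (simp add: power2_eq_square algebra_simps)
  also have "\<dots> = z1 * (z1 + z2) * z2 * e"
    unfolding S by (simp add: power2_eq_square algebra_simps)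
  finally have quad: "z1 * \<alpha>\<^sup>2 + z2 * \<beta>\<^sup>2 = e" using nz by simp
  have "z1 * \<alpha> * (\<alpha> - \<beta>) = (z1 * \<alpha>\<^sup>2 + z2 * \<beta>\<^sup>2) - (z1 * \<alpha> + z2 * \<beta>) * \<beta>"
    by (simp add: power2_eq_square algebra_simps)
  also have "\<dots> = e * (1 - \<beta>)" unfolding lin quad by (simp add: algebra_simps)
  finally show "z1 * \<alpha> * (\<alpha> - \<beta>) = e * (1 - \<beta>)" .
  have "z2 * \<beta> * (\<beta> - \<alpha>) = (z1 * \<alpha>\<^sup>2 + z2 * \<beta>\<^sup>2) - (z1 * \<alpha> + z2 * \<beta>) * \<alpha>"
    by (simp add: power2_eq_square algebra_simps)
  also have "\<dots> = e * (1 - \<alpha>)" unfolding lin quad by (simp add: algebra_simps)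
  finally show "z2 * \<beta> * (\<beta> - \<alpha>) = e * (1 - \<alpha>)" .
qed

lemma tendsto_csqrt_zero:
  assumes "(f \<longlongrightarrow> 0) F"
  shows "((\<lambda>x. csqrt (f x)) \<longlongrightarrow> 0) F"
proof (rule tendsto_norm_zero_cancel)
  show "((\<lambda>x. norm (csqrt (f x))) \<longlongrightarrow> 0) F"
    using tendsto_real_sqrt[OF tendsto_norm_zero[OF assms]] by simp
qed

context
  fixes \<epsilon> :: "nat \<Rightarrow> complex"
  assumes \<epsilon>: "\<And>k. \<epsilon> k \<in> ball 0 1 - {0}" and \<epsilon>0: "\<epsilon> \<longlonglongrightarrow> 0"
begin

lemma \<epsilon>_nonzero: "\<epsilon> k \<noteq> 0"
  using \<epsilon>[of k] by simp

text \<open>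
  Three poles on curves that tend to \<open>\<zeta> \<mapsto> \<zeta>\<^sup>2 z\<close>. This limit lies in the bidisk for \<open>\<bar>\<zeta>\<bar>\<^sup>2 \<bar>z\<bar> < 1\<close>, which
  allows every radius \<open>R\<close> below \<open>1 / sqrt \<bar>z\<bar>\<close>; in the limit \<open>- 3 ln R\<close> becomes \<open>3 / 2 ln \<bar>z\<bar>\<close>.
\<close>

lemma limit_bound_generic:
  assumes z: "(z1, z2) \<in> bidisk" and nz: "z1 \<noteq> 0" "z2 \<noteq> 0" "z1 + z2 \<noteq> 0"
    and lim: "(\<lambda>k. green bidisk {(0, 0), (\<epsilon> k, 0), (0, \<epsilon> k)} (z1, z2)) \<longlonglongrightarrow> L"
  shows "L \<le> ereal (3 / 2) * elog (maxnorm (z1, z2))"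
proof -
  define M where "M = maxnorm (z1, z2)"
  have M: "norm z1 \<le> M" "norm z2 \<le> M" "0 < M" "M < 1"
    using z nz by (auto simp: M_def maxnorm_def bidisk_def less_max_iff_disj)
  define \<alpha> where "\<alpha> k = (\<epsilon> k * z1 + csqrt (\<epsilon> k * z1 * z2 * (z1 + z2 - \<epsilon> k))) / (z1 * (z1 + z2))" for k
  define \<beta> where "\<beta> k = (\<epsilon> k - z1 * \<alpha> k) / z2" for k
  have rel: "z1 * \<alpha> k * (\<alpha> k - \<beta> k) = \<epsilon> k * (1 - \<beta> k)" "z2 * \<beta> k * (\<beta> k - \<alpha> k) = \<epsilon> k * (1 - \<alpha> k)" for k
    by (rule three_pole_parameters[OF nz power2_csqrt \<alpha>_def \<beta>_def])+
  have "(\<lambda>k. \<epsilon> k * z1 * z2 * (z1 + z2 - \<epsilon> k)) \<longlonglongrightarrow> 0 * z1 * z2 * (z1 + z2 - 0)"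
    by (intro tendsto_intros \<epsilon>0)
  then have "(\<lambda>k. csqrt (\<epsilon> k * z1 * z2 * (z1 + z2 - \<epsilon> k))) \<longlonglongrightarrow> 0"
    by (intro tendsto_csqrt_zero) simp
  then have "\<alpha> \<longlonglongrightarrow> (0 * z1 + 0) / (z1 * (z1 + z2))"
    unfolding \<alpha>_def using nz by (intro tendsto_intros \<epsilon>0) auto
  then have \<alpha>0: "\<alpha> \<longlonglongrightarrow> 0" by simp
  have "\<beta> \<longlonglongrightarrow> (0 - z1 * 0) / z2"
    unfolding \<beta>_def using nz by (intro tendsto_intros \<epsilon>0 \<alpha>0) auto
  then have \<beta>0: "\<beta> \<longlonglongrightarrow> 0" by simp
  have ne1: "\<forall>\<^sub>F k in sequentially. \<alpha> k \<noteq> 1 \<and> \<beta> k \<noteq> 1"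
    using tendsto_imp_eventually_ne[OF \<alpha>0, of 1] tendsto_imp_eventually_ne[OF \<beta>0, of 1]
    by (auto intro: eventually_conj)
  define a where "a k = z1 / (1 - \<beta> k)" for k
  define b where "b k = z2 / (1 - \<alpha> k)" for k
  define curve where "curve k = parabola (0, 0) (- a k * \<beta> k, - b k * \<alpha> k) (a k, b k) 0" for k
  have curve: "curve k \<zeta> = (a k * \<zeta> * (\<zeta> - \<beta> k), b k * \<zeta> * (\<zeta> - \<alpha> k))" for k \<zeta>
    by (simp add: curve_def parabola_def power2_eq_square algebra_simps)
  define \<sigma> where "\<sigma> j k = [0, \<alpha> k, \<beta> k] ! j" for j k
  have less3: "j < 3 \<longleftrightarrow> j = 0 \<or> j = 1 \<or> j = (2::nat)" for j by auto
  have on_poles: "\<forall>\<^sub>F k in sequentially. curve k 0 = (0, 0) \<and> curve k (\<alpha> k) = (\<epsilon> k, 0) \<and> curve k (\<beta> k) = (0, \<epsilon> k)"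
    using ne1
  proof eventually_elim
    case (elim k)
    then show ?case
      using rel[of k] by (simp add: curve a_def b_def)
  qed
  have R0: "1 < 1 / sqrt M" using M by (simp add: real_sqrt_lt_1_iff)
  have bound: "L \<le> ereal (real 3 * (ln (norm (1::complex)) - ln R))" if R: "1 < R" "R < 1 / sqrt M" for R
  proof (rule green_parabola_limit_bound[OF lim, where \<sigma> = \<sigma>])
    show "(\<lambda>k. \<sigma> j k) \<longlonglongrightarrow> 0" if "j < 3" for j
      using that \<alpha>0 \<beta>0 by (auto simp: \<sigma>_def less3)
    show "\<forall>\<^sub>F k in sequentially. parabola (0, 0) (- a k * \<beta> k, - b k * \<alpha> k) (a k, b k) 0 1 = (z1, z2)"
      using ne1 unfolding curve_def[symmetric]
      by eventually_elim (simp add: curve a_def b_def)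
    show "\<forall>\<^sub>F k in sequentially. parabola (0, 0) (- a k * \<beta> k, - b k * \<alpha> k) (a k, b k) 0 (\<sigma> j k) \<in> {(0, 0), (\<epsilon> k, 0), (0, \<epsilon> k)}"
      if "j < 3" for j
      using on_poles unfolding curve_def[symmetric]
      by eventually_elim (use that in \<open>auto simp: \<sigma>_def less3\<close>)
    show "\<forall>\<^sub>F k in sequentially. inj_on (\<lambda>j. \<sigma> j k) {..<3}"
      using ne1
    proof eventually_elim
      case (elim k)
      then have "\<epsilon> k * (1 - \<beta> k) \<noteq> 0" "\<epsilon> k * (1 - \<alpha> k) \<noteq> 0" by (auto simp: \<epsilon>_nonzero)
      then have "\<alpha> k \<noteq> 0 \<and> \<beta> k \<noteq> 0 \<and> \<alpha> k \<noteq> \<beta> k"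
        unfolding rel[symmetric] by auto
      then show ?case by (auto simp: inj_on_def less3 \<sigma>_def)
    qed
    show "\<forall>\<^sub>F k in sequentially. \<forall>\<zeta>. norm \<zeta> \<le> R \<longrightarrow> parabola (0, 0) (- a k * \<beta> k, - b k * \<alpha> k) (a k, b k) 0 \<zeta> \<in> bidisk"
    proof -
      have "R * sqrt M < 1" using R M by (simp add: field_simps)
      then have "(R * sqrt M)\<^sup>2 < 1" using R M by (intro power_less_one_iff[THEN iffD2]) auto
      then have "R\<^sup>2 * M < 1" using M by (simp add: power_mult_distrib)
      moreover have "norm z1 * R * (R + norm (0::complex)) \<le> R\<^sup>2 * M" "norm z2 * R * (R + norm (0::complex)) \<le> R\<^sup>2 * M"
        using M R by (auto simp: power2_eq_square mult.commute mult_left_mono)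
      moreover have "(\<lambda>k. norm (a k) * R * (R + norm (\<beta> k))) \<longlonglongrightarrow> norm (z1 / (1 - 0)) * R * (R + norm (0::complex))"
        unfolding a_def by (intro tendsto_intros \<beta>0) auto
      moreover have "(\<lambda>k. norm (b k) * R * (R + norm (\<alpha> k))) \<longlonglongrightarrow> norm (z2 / (1 - 0)) * R * (R + norm (0::complex))"
        unfolding b_def by (intro tendsto_intros \<alpha>0) auto
      ultimately have "\<forall>\<^sub>F k in sequentially. norm (a k) * R * (R + norm (\<beta> k)) < 1"
          "\<forall>\<^sub>F k in sequentially. norm (b k) * R * (R + norm (\<alpha> k)) < 1"
        by (auto intro!: order_tendstoD(2))
      then show ?thesis
      proof eventually_elim
        case (elim k)
        have "norm (c * \<zeta> * (\<zeta> - d)) < 1" if "norm \<zeta> \<le> R" "norm c * R * (R + norm d) < 1" for c d \<zeta> :: complex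
        proof -
          have "norm (\<zeta> - d) \<le> R + norm d" using norm_triangle_ineq4[of \<zeta> d] that by linarith
          then have "norm (c * \<zeta> * (\<zeta> - d)) \<le> norm c * R * (R + norm d)"
            unfolding norm_mult using that R by (intro mult_mono) auto
          then show ?thesis using that by linarith
        qed
        then show ?case using elim unfolding curve_def[symmetric] curve by (simp add: bidisk_def)
      qed
    qed
  qed (use R in auto)
  have "L \<le> ereal (real 3 * (ln (norm (1::complex)) - ln (1 / sqrt M)))"
    by (rule ereal_le_radius_limit[OF zero_le_one R0 bound])
  also have "real 3 * (ln (norm (1::complex)) - ln (1 / sqrt M)) = 3 / 2 * ln M"
    using M by (simp add: ln_div ln_sqrt)
  also have "ereal \<dots> = ereal (3 / 2) * elog (maxnorm (z1, z2))"
    using M by (simp add: elog_def M_def)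
  finally show ?thesis .
qed

text \<open>
  The line through \<open>(\<epsilon>, 0)\<close> and \<open>(0, \<epsilon>)\<close> misses \<open>(z, - z)\<close> by \<open>\<epsilon>\<close>. Bending it by a multiple \<open>c\<close> of
  \<open>\<zeta> (\<zeta> - \<epsilon>)\<close>, which keeps both poles, makes it hit that point, and \<open>c\<close> tends to 0 with \<open>\<epsilon>\<close>.
\<close>

lemma limit_bound_antidiagonal:
  assumes z: "norm z < 1" "z \<noteq> 0"
    and lim: "(\<lambda>k. green bidisk {(0, 0), (\<epsilon> k, 0), (0, \<epsilon> k)} (z, - z)) \<longlonglongrightarrow> L"
  shows "L \<le> 2 * elog (norm z)"
proof -
  define c where "c k = \<epsilon> k / (z * (z - \<epsilon> k))" for k
  have "c \<longlonglongrightarrow> 0 / (z * (z - 0))"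
    unfolding c_def using z by (intro tendsto_intros \<epsilon>0) auto
  then have c0: "c \<longlonglongrightarrow> 0" by simp
  have ne: "\<forall>\<^sub>F k in sequentially. \<epsilon> k \<noteq> z"
    using tendsto_imp_eventually_ne[OF \<epsilon>0] z by auto
  define curve where "curve k = parabola (0, \<epsilon> k) (1, - 1 + c k * \<epsilon> k) (0, - c k) 0" for k
  have curve: "curve k \<zeta> = (\<zeta>, \<epsilon> k - \<zeta> - c k * \<zeta> * (\<zeta> - \<epsilon> k))" for k \<zeta>
    by (simp add: curve_def parabola_def power2_eq_square algebra_simps)
  define \<sigma> where "\<sigma> j k = [0, \<epsilon> k] ! j" for j k
  have less2: "j < 2 \<longleftrightarrow> j = 0 \<or> j = (1::nat)" for j by auto
  have bound: "L \<le> ereal (real 2 * (ln (norm z) - ln R))" if R: "norm z < R" "R < 1" for R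
  proof (rule green_parabola_limit_bound[OF lim, where \<sigma> = \<sigma>])
    show "(\<lambda>k. \<sigma> j k) \<longlonglongrightarrow> 0" if "j < 2" for j
      using that \<epsilon>0 by (auto simp: \<sigma>_def less2)
    show "\<forall>\<^sub>F k in sequentially. parabola (0, \<epsilon> k) (1, - 1 + c k * \<epsilon> k) (0, - c k) 0 z = (z, - z)"
      using ne unfolding curve_def[symmetric]
      by eventually_elim (use z in \<open>simp add: curve c_def\<close>)
    show "\<forall>\<^sub>F k in sequentially. parabola (0, \<epsilon> k) (1, - 1 + c k * \<epsilon> k) (0, - c k) 0 (\<sigma> j k) \<in> {(0, 0), (\<epsilon> k, 0), (0, \<epsilon> k)}"
      if "j < 2" for j
      using that unfolding curve_def[symmetric] by (auto simp: curve \<sigma>_def less2)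
    show "\<forall>\<^sub>F k in sequentially. inj_on (\<lambda>j. \<sigma> j k) {..<2}"
      by (intro always_eventually) (auto simp: inj_on_def less2 \<sigma>_def \<epsilon>_nonzero)
    show "\<forall>\<^sub>F k in sequentially. \<forall>\<zeta>. norm \<zeta> \<le> R \<longrightarrow> parabola (0, \<epsilon> k) (1, - 1 + c k * \<epsilon> k) (0, - c k) 0 \<zeta> \<in> bidisk"
    proof -
      have "(\<lambda>k. norm (\<epsilon> k) + R + norm (c k) * R * (R + norm (\<epsilon> k))) \<longlonglongrightarrow> norm (0::complex) + R + norm (0::complex) * R * (R + norm (0::complex))"
        by (intro tendsto_intros \<epsilon>0 c0)
      then have "\<forall>\<^sub>F k in sequentially. norm (\<epsilon> k) + R + norm (c k) * R * (R + norm (\<epsilon> k)) < 1"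
        using R by (intro order_tendstoD(2)) auto
      then show ?thesis
      proof eventually_elim
        case (elim k)
        have "norm (\<epsilon> k - \<zeta> - c k * \<zeta> * (\<zeta> - \<epsilon> k)) < 1" if "norm \<zeta> \<le> R" for \<zeta>
        proof -
          have "0 \<le> R" using that norm_ge_zero order_trans by blast
          have "norm (\<zeta> - \<epsilon> k) \<le> R + norm (\<epsilon> k)" using norm_triangle_ineq4[of \<zeta> "\<epsilon> k"] that by linarith
          then have "norm (c k * \<zeta> * (\<zeta> - \<epsilon> k)) \<le> norm (c k) * R * (R + norm (\<epsilon> k))"
            unfolding norm_mult using that \<open>0 \<le> R\<close> by (intro mult_mono) auto
          moreover have "norm (\<epsilon> k - \<zeta>) \<le> norm (\<epsilon> k) + R" using norm_triangle_ineq4[of "\<epsilon> k" \<zeta>] that by linarith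
          ultimately show ?thesis
            using norm_triangle_ineq4[of "\<epsilon> k - \<zeta>" "c k * \<zeta> * (\<zeta> - \<epsilon> k)"] elim by linarith
        qed
        then show ?case using R unfolding curve_def[symmetric] curve by (simp add: bidisk_def)
      qed
    qed
  qed (use R z in auto)
  have "L \<le> ereal (real 2 * (ln (norm z) - ln 1))"
    by (rule ereal_le_radius_limit[OF norm_ge_zero z(1) bound])
  also have "\<dots> = 2 * elog (norm z)" using z by (simp add: elog_def)
  finally show ?thesis .
qed

lemma limit_bound_axis:
  assumes m: "m \<in> {(1, 0), (0, 1)}" and z: "norm \<zeta>0 < 1" "\<zeta>0 \<noteq> 0"
    and lim: "(\<lambda>k. green bidisk {(0, 0), (\<epsilon> k, 0), (0, \<epsilon> k)} (\<zeta>0 * fst m, \<zeta>0 * snd m)) \<longlonglongrightarrow> L"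
  shows "L \<le> 2 * elog (norm \<zeta>0)"
proof -
  define \<sigma> where "\<sigma> j k = [0, \<epsilon> k] ! j" for j k
  have less2: "j < 2 \<longleftrightarrow> j = 0 \<or> j = (1::nat)" for j by auto
  have bound: "L \<le> ereal (real 2 * (ln (norm \<zeta>0) - ln R))" if R: "norm \<zeta>0 < R" "R < 1" for R
  proof (rule green_parabola_limit_bound[OF lim, where \<sigma> = \<sigma>])
    show "(\<lambda>k. \<sigma> j k) \<longlonglongrightarrow> 0" if "j < 2" for j
      using that \<epsilon>0 by (auto simp: \<sigma>_def less2)
    show "\<forall>\<^sub>F k in sequentially. parabola (0, 0) m (0, 0) 0 (\<sigma> j k) \<in> {(0, 0), (\<epsilon> k, 0), (0, \<epsilon> k)}"
      if "j < 2" for j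
      using that m by (auto simp: parabola_def \<sigma>_def less2)
    show "\<forall>\<^sub>F k in sequentially. inj_on (\<lambda>j. \<sigma> j k) {..<2}"
      by (intro always_eventually) (auto simp: inj_on_def less2 \<sigma>_def \<epsilon>_nonzero)
    show "\<forall>\<^sub>F k in sequentially. \<forall>\<zeta>. norm \<zeta> \<le> R \<longrightarrow> parabola (0, 0) m (0, 0) 0 \<zeta> \<in> bidisk"
      using R m by (intro always_eventually) (auto simp: bidisk_def parabola_def)
  qed (use R z in \<open>auto simp: parabola_def\<close>)
  have "L \<le> ereal (real 2 * (ln (norm \<zeta>0) - ln 1))"
    by (rule ereal_le_radius_limit[OF norm_ge_zero z(1) bound])
  also have "\<dots> = 2 * elog (norm \<zeta>0)" using z by (simp add: elog_def)
  finally show ?thesis .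
qed

lemma limit_lower_bound_antidiagonal:
  assumes z: "norm z < 1" "z \<noteq> 0"
    and lim: "(\<lambda>k. green bidisk {(0, 0), (\<epsilon> k, 0), (0, \<epsilon> k)} (z, - z)) \<longlonglongrightarrow> L"
  shows "2 * elog (norm z) \<le> L"
proof -
  have low: "ereal (2 * ln (norm z) - ln (1 + norm (\<epsilon> k))) \<le> green bidisk {(0, 0), (\<epsilon> k, 0), (0, \<epsilon> k)} (z, - z)" for k
  proof -
    have pos: "1 + norm (\<epsilon> k) > 0" by (simp add: add_pos_nonneg)
    have "ereal (2 * ln (norm z) - ln (1 + norm (\<epsilon> k))) = elog (norm z * norm z / (1 + norm (\<epsilon> k)))"
      using z pos by (simp add: elog_def ln_mult ln_div not_le)
    also have "\<dots> \<le> pole_ideal_log (\<epsilon> k) (z, - z)"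
      unfolding pole_ideal_log_def using pos by (intro elog_mono divide_right_mono) auto
    also have "\<dots> \<le> green bidisk {(0, 0), (\<epsilon> k, 0), (0, \<epsilon> k)} (z, - z)"
      unfolding green_def using \<epsilon>[of k] by (intro SUP_upper pole_ideal_log_in_green_class) auto
    finally show ?thesis .
  qed
  have "(\<lambda>k. ereal (2 * ln (norm z) - ln (1 + norm (\<epsilon> k)))) \<longlonglongrightarrow> ereal (2 * ln (norm z) - ln (1 + norm (0::complex)))"
    unfolding lim_ereal by (intro tendsto_intros \<epsilon>0) auto
  from LIMSEQ_le[OF this lim] low have "ereal (2 * ln (norm z)) \<le> L"
    by simp
  then show ?thesis using z by (simp add: elog_def)
qed

end

theorem corollary1p2:
  fixes \<epsilon> :: "nat \<Rightarrow> complex" and g :: "complex \<times> complex \<Rightarrow> ereal"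
  assumes "\<And>k. \<epsilon> k \<in> ball 0 1 - {0}"
    and "\<epsilon> \<longlonglongrightarrow> 0"
    and "\<And>z. z \<in> bidisk \<Longrightarrow> g z \<in> {-\<infinity>..0}"
    and "\<And>z. z \<in> bidisk \<Longrightarrow>
           (\<lambda>k. green bidisk {(0, 0), (\<epsilon> k, 0), (0, \<epsilon> k)} z) \<longlonglongrightarrow> g z"
  shows "(\<forall>z\<in>bidisk. g z \<le> ereal (3 / 2) * elog (maxnorm z)) \<and>
         (\<forall>z\<^sub>1\<in>ball 0 1. g (z\<^sub>1, - z\<^sub>1) = 2 * elog (norm z\<^sub>1))"
proof -
  have zero: "g (0, 0) = -\<infinity>"
  proof -
    have b: "(0, 0) \<in> bidisk" by (simp add: bidisk_def)
    have "green bidisk {(0, 0), (\<epsilon> k, 0), (0, \<epsilon> k)} (0, 0) = -\<infinity>" for k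
      using b by (intro green_at_pole) auto
    then have "(\<lambda>k::nat. -\<infinity>) \<longlonglongrightarrow> g (0, 0)" using assms(4)[OF b] by simp
    then show ?thesis using LIMSEQ_unique[OF tendsto_const] by metis
  qed
  have antidiagonal: "g (z, - z) = 2 * elog (norm z)" if "norm z < 1" for z
  proof (cases "z = 0")
    case True
    then show ?thesis using zero by (simp add: elog_def)
  next
    case False
    have "(z, - z) \<in> bidisk" using that by (simp add: bidisk_def)
    note lim = assms(4)[OF this]
    show ?thesis
      by (rule antisym[OF limit_bound_antidiagonal limit_lower_bound_antidiagonal];
          rule assms(1) assms(2) that False lim)
  qed
  have weaken: "2 * elog x \<le> ereal (3 / 2) * elog x" if "0 < x" "x < 1" for x
    using that by (simp add: elog_def)
  have "g (z1, z2) \<le> ereal (3 / 2) * elog (maxnorm (z1, z2))" if z: "(z1, z2) \<in> bidisk" for z1 z2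
  proof -
    have n: "norm z1 < 1" "norm z2 < 1" using z by (auto simp: bidisk_def)
    consider "z1 = 0" "z2 = 0" | "z1 = 0" "z2 \<noteq> 0" | "z1 \<noteq> 0" "z2 = 0"
      | "z1 \<noteq> 0" "z2 \<noteq> 0" "z1 + z2 = 0" | "z1 \<noteq> 0" "z2 \<noteq> 0" "z1 + z2 \<noteq> 0" by blast
    then show ?thesis
    proof cases
      case 1
      then show ?thesis using zero by simp
    next
      case 2
      have "g (z1, z2) \<le> 2 * elog (norm z2)"
        by (rule limit_bound_axis[OF assms(1,2), of "(0, 1)"]) (use 2 n assms(4)[OF z] in auto)
      also have "\<dots> \<le> ereal (3 / 2) * elog (norm z2)" using 2 n by (intro weaken) auto
      finally show ?thesis using 2 by (simp add: maxnorm_def)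
    next
      case 3
      have "g (z1, z2) \<le> 2 * elog (norm z1)"
        by (rule limit_bound_axis[OF assms(1,2), of "(1, 0)"]) (use 3 n assms(4)[OF z] in auto)
      also have "\<dots> \<le> ereal (3 / 2) * elog (norm z1)" using 3 n by (intro weaken) auto
      finally show ?thesis using 3 by (simp add: maxnorm_def)
    next
      case 4
      then have z2: "z2 = - z1" by (simp add: add_eq_0_iff)
      have "g (z1, z2) = 2 * elog (norm z1)" unfolding z2 by (rule antidiagonal[OF n(1)])
      also have "\<dots> \<le> ereal (3 / 2) * elog (norm z1)" using 4 n by (intro weaken) auto
      finally show ?thesis using z2 by (simp add: maxnorm_def)
    next
      case 5
      then show ?thesis by (intro limit_bound_generic[OF assms(1,2) z _ _ _ assms(4)[OF z]])
    qed
  qed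
  then show ?thesis using antidiagonal by auto
qed

end
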